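(* Let $0\le M<N$ be integers and write $x=(y,z)\in\mathbb{R}^{M}\times\mathbb{R}^{N-M}$ for points of $\mathbb{R}^N$. Let $f:\mathbb{R}\to\mathbb{R}$ be a $C^1$ function such that $f(0)=0$ and, for some $\varepsilon>0$, $f'(s)\le 0$ for all $s\in(0,\varepsilon)$. Let $u>0$ be a bounded solution to $-\Delta u=f(u)$ in $\mathbb{R}^N$. Assume that (i) $u$ is periodic in $y$; (ii) $u(y,z)\to 0$ as $|z|\to\infty$, uniformly in $y$. Then $u$ is radially symmetric and decreasing with respect to $z$, that is, there exists $z_0\in\mathbb{R}^{N-M}$ such that $u(y,z)$ depends only on $y$ and $|z-z_0|$, and for every $1\le j\le N-M$ one has $\frac{\partial u}{\partial z_j}(y,z)<0$ whenever $z_j>(z_0)_j$.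
   Context: Solutions are classical ($C^2$). A function $u:\mathbb{R}^N\to\mathbb{R}$ is periodic in $y$ of period $T=(T_1,\dots,T_M)$ (with $T_j>0$) if $u(y+T_je_j,z)=u(y,z)$ for every $(y,z)\in\mathbb{R}^M\times\mathbb{R}^{N-M}$ and every $1\le j\le M$, where $\{e_1,\dots,e_M\}$ is the standard basis of $\mathbb{R}^M$. When $M=0$ there are no $y$ variables, $z=x$, and condition (i) is void. *)

theory Defs
  imports "HOL-Analysis.Analysis"
begin

text \<open>
  A splitting of the coordinates of \<open>real ^ 'n\<close> into \<open>x = (y, z)\<close> is given by the set \<open>Y\<close> of
  indices of the \<open>y\<close> coordinates; the \<open>z\<close> coordinates are those with index outside \<open>Y\<close>. Then
  \<open>N = CARD('n)\<close> and \<open>M = card Y\<close>. A set of indices is used instead of a product type because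
  index types are nonempty, so \<open>real ^ 'm\<close> cannot represent the case \<open>M = 0\<close>.
  The two factors are identified with the corresponding coordinate subspaces.
\<close>

definition y_part :: "'n set \<Rightarrow> real ^ 'n \<Rightarrow> real ^ 'n" where
  "y_part Y x = (\<chi> i. if i \<in> Y then x $ i else 0)"

definition z_part :: "'n set \<Rightarrow> real ^ 'n \<Rightarrow> real ^ 'n" where
  "z_part Y x = (\<chi> i. if i \<in> Y then 0 else x $ i)"

definition partial_deriv :: "'n::finite \<Rightarrow> (real ^ 'n \<Rightarrow> real) \<Rightarrow> real ^ 'n \<Rightarrow> real" where
  "partial_deriv i u x = frechet_derivative u (at x) (axis i 1)"

definition C1_function :: "(real ^ 'n::finite \<Rightarrow> real) \<Rightarrow> bool" where
  "C1_function u \<longleftrightarrow>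
     (\<forall>x. u differentiable (at x)) \<and> (\<forall>i. continuous_on UNIV (partial_deriv i u))"

definition C2_function :: "(real ^ 'n::finite \<Rightarrow> real) \<Rightarrow> bool" where
  "C2_function u \<longleftrightarrow> C1_function u \<and> (\<forall>i. C1_function (partial_deriv i u))"

definition laplacian :: "(real ^ 'n::finite \<Rightarrow> real) \<Rightarrow> real ^ 'n \<Rightarrow> real" where
  "laplacian u x = (\<Sum>i\<in>UNIV. partial_deriv i (partial_deriv i u) x)"

text \<open>Only the components \<open>T $ j\<close> with \<open>j \<in> Y\<close> are relevant; for \<open>Y = {}\<close> the condition is void.\<close>

definition periodic_in_y :: "'n::finite set \<Rightarrow> (real ^ 'n \<Rightarrow> real) \<Rightarrow> bool" where
  "periodic_in_y Y u \<longleftrightarrow>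
     (\<exists>T :: real ^ 'n. \<forall>j\<in>Y. T $ j > 0 \<and> (\<forall>x. u (x + T $ j *\<^sub>R axis j 1) = u x))"

text \<open>\<open>R\<close> is chosen independently of the \<open>y\<close> coordinates of \<open>x\<close>.\<close>

definition vanishes_uniformly_in_y :: "'n::finite set \<Rightarrow> (real ^ 'n \<Rightarrow> real) \<Rightarrow> bool" where
  "vanishes_uniformly_in_y Y u \<longleftrightarrow>
     (\<forall>e>0. \<exists>R. \<forall>x. norm (z_part Y x) > R \<longrightarrow> \<bar>u x\<bar> < e)"

end

theory Submission
  imports Defs
begin

text \<open>
  The method of moving planes. For a unit vector \<open>e\<close> in the \<open>z\<close> coordinates compare \<open>u\<close> with its
  reflection in the hyperplane \<open>x \<bullet> e = l\<close>: let \<open>w\<close> be the reflected function minus \<open>u\<close> on the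
  half-space \<open>x \<bullet> e \<ge> l\<close>. If \<open>w\<close> is negative somewhere, periodicity and decay provide a negative
  minimum (after division by a suitable positive weight), and since \<open>f\<close> is nonincreasing on
  \<open>(0, \<epsilon>)\<close> the second derivative test forces \<open>u \<ge> \<epsilon>\<close> there, so the minimum stays in a region
  that is compact modulo periods. Hence \<open>w \<ge> 0\<close> for large \<open>l\<close>. At the infimum of the positions \<open>l\<close> beyond
  which this persists, the strong minimum principle gives either \<open>w = 0\<close> or \<open>w > 0\<close> with
  \<open>\<partial>u/\<partial>e < 0\<close> on the hyperplane (Hopf), and the latter contradicts the existence of negative
  minima for slightly smaller \<open>l\<close>. So \<open>u\<close> is symmetric with respect to one hyperplane for each
  \<open>e\<close>; as \<open>u\<close> is not invariant under any nonzero translation in \<open>z\<close>, all of these hyperplanes pass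
  through the point determined by the coordinate directions.
\<close>

subsection \<open>Second derivative test for the Laplacian\<close>

text \<open>A relation carrying witnesses, so that sums, multiples and reflections need no separate
  differentiability proofs. The gradient exists everywhere, its derivative (the Hessian) at
  \<open>x\<close>, and \<open>L\<close> is the trace of that Hessian.\<close>

definition has_laplacian :: "('a::euclidean_space \<Rightarrow> real) \<Rightarrow> real \<Rightarrow> 'a \<Rightarrow> bool" where
  "has_laplacian v L x \<longleftrightarrow>
     (\<exists>G H. (\<forall>y. (v has_derivative (\<lambda>h. G y \<bullet> h)) (at y)) \<and> (G has_derivative H) (at x) \<and>
        L = (\<Sum>b\<in>Basis. H b \<bullet> b))"

lemma has_laplacian_differentiable: "has_laplacian v L x \<Longrightarrow> v differentiable (at y)"
  unfolding has_laplacian_def differentiable_def by blast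

lemma has_laplacian_continuous_on: "has_laplacian v L x \<Longrightarrow> continuous_on S v"
  by (meson has_laplacian_differentiable continuous_at_imp_continuous_on
      differentiable_imp_continuous_within)

lemma has_laplacian_const: "has_laplacian (\<lambda>x. c) 0 x"
  unfolding has_laplacian_def
  by (rule exI[of _ "\<lambda>y. 0"], rule exI[of _ "\<lambda>h. 0"])
    (auto intro!: has_derivative_eq_rhs[OF has_derivative_const])

lemma has_laplacian_add:
  assumes "has_laplacian v L x" "has_laplacian v' L' x"
  shows "has_laplacian (\<lambda>x. v x + v' x) (L + L') x"
proof -
  obtain G H G' H' where
    G: "\<And>y. (v has_derivative (\<lambda>h. G y \<bullet> h)) (at y)" "(G has_derivative H) (at x)"
      "L = (\<Sum>b\<in>Basis. H b \<bullet> b)"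
    and G': "\<And>y. (v' has_derivative (\<lambda>h. G' y \<bullet> h)) (at y)" "(G' has_derivative H') (at x)"
      "L' = (\<Sum>b\<in>Basis. H' b \<bullet> b)"
    using assms unfolding has_laplacian_def by blast
  show ?thesis
    unfolding has_laplacian_def
  proof (rule exI[of _ "\<lambda>y. G y + G' y"], rule exI[of _ "\<lambda>h. H h + H' h"], intro conjI allI)
    show "((\<lambda>x. v x + v' x) has_derivative (\<lambda>h. (G y + G' y) \<bullet> h)) (at y)" for y
      using has_derivative_add[OF G(1) G'(1)] by (simp add: inner_add_left)
    show "((\<lambda>y. G y + G' y) has_derivative (\<lambda>h. H h + H' h)) (at x)"
      by (rule has_derivative_add[OF G(2) G'(2)])
    show "L + L' = (\<Sum>b\<in>Basis. (H b + H' b) \<bullet> b)"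
      by (simp add: G(3) G'(3) inner_add_left sum.distrib)
  qed
qed

lemma has_laplacian_cmult:
  assumes "has_laplacian v L x"
  shows "has_laplacian (\<lambda>x. c * v x) (c * L) x"
proof -
  obtain G H where
    G: "\<And>y. (v has_derivative (\<lambda>h. G y \<bullet> h)) (at y)" "(G has_derivative H) (at x)"
      "L = (\<Sum>b\<in>Basis. H b \<bullet> b)"
    using assms unfolding has_laplacian_def by blast
  show ?thesis
    unfolding has_laplacian_def
  proof (rule exI[of _ "\<lambda>y. c *\<^sub>R G y"], rule exI[of _ "\<lambda>h. c *\<^sub>R H h"], intro conjI allI)
    show "((\<lambda>x. c * v x) has_derivative (\<lambda>h. (c *\<^sub>R G y) \<bullet> h)) (at y)" for y
      using has_derivative_mult_right[OF G(1), of c] by simp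
    show "((\<lambda>y. c *\<^sub>R G y) has_derivative (\<lambda>h. c *\<^sub>R H h)) (at x)"
      by (rule has_derivative_scaleR_right[OF G(2)])
    show "c * L = (\<Sum>b\<in>Basis. (c *\<^sub>R H b) \<bullet> b)"
      by (simp add: G(3) sum_distrib_left)
  qed
qed

lemma has_laplacian_diff:
  assumes "has_laplacian v L x" "has_laplacian v' L' x"
  shows "has_laplacian (\<lambda>x. v x - v' x) (L - L') x"
  using has_laplacian_add[OF assms(1) has_laplacian_cmult[OF assms(2), of "-1"]] by simp

text \<open>Provides the exponential part of the superharmonic weight on half-spaces.\<close>

lemma has_laplacian_exp_linear:
  "has_laplacian (\<lambda>x. exp (l - x \<bullet> e)) (exp (l - x \<bullet> e) * (e \<bullet> e)) x"
  unfolding has_laplacian_def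
proof (rule exI[of _ "\<lambda>y. (- exp (l - y \<bullet> e)) *\<^sub>R e"],
    rule exI[of _ "\<lambda>h. (exp (l - x \<bullet> e) * (h \<bullet> e)) *\<^sub>R e"], intro conjI allI)
  show "((\<lambda>x. exp (l - x \<bullet> e)) has_derivative (\<lambda>h. (- exp (l - y \<bullet> e)) *\<^sub>R e \<bullet> h)) (at y)" for y
    by (auto intro!: derivative_eq_intros simp: inner_commute)
  show "((\<lambda>y. (- exp (l - y \<bullet> e)) *\<^sub>R e) has_derivative
      (\<lambda>h. (exp (l - x \<bullet> e) * (h \<bullet> e)) *\<^sub>R e)) (at x)"
    by (rule derivative_eq_intros refl | simp add: mult.commute)+
  show "exp (l - x \<bullet> e) * (e \<bullet> e) =
      (\<Sum>b\<in>Basis. (exp (l - x \<bullet> e) * (b \<bullet> e)) *\<^sub>R e \<bullet> b)"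
    by (subst euclidean_inner[of e e])
      (simp add: sum_distrib_left inner_commute mult.assoc)
qed

text \<open>The barrier of the Hopf lemma is built from this Gaussian. Its Hessian is a multiple of
  the identity plus a rank one term along \<open>x - p\<close>.\<close>

lemma has_laplacian_gaussian:
  fixes x p :: "'a::euclidean_space"
  shows "has_laplacian (\<lambda>x. exp (- \<alpha> * ((x - p) \<bullet> (x - p))))
    ((4 * \<alpha>\<^sup>2 * ((x - p) \<bullet> (x - p)) - 2 * \<alpha> * DIM('a)) * exp (- \<alpha> * ((x - p) \<bullet> (x - p)))) x"
proof -
  let ?E = "\<lambda>x. exp (- \<alpha> * ((x - p) \<bullet> (x - p)))"
  show ?thesis
    unfolding has_laplacian_def
  proof (rule exI[of _ "\<lambda>y. (- 2 * \<alpha> * ?E y) *\<^sub>R (y - p)"],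
      rule exI[of _ "\<lambda>h. (4 * \<alpha>\<^sup>2 * ?E x * ((x - p) \<bullet> h)) *\<^sub>R (x - p) - (2 * \<alpha> * ?E x) *\<^sub>R h"],
      intro conjI allI)
    show "(?E has_derivative (\<lambda>h. (- 2 * \<alpha> * ?E y) *\<^sub>R (y - p) \<bullet> h)) (at y)" for y
      by (rule derivative_eq_intros refl | simp add: inner_commute fun_eq_iff)+
    show "((\<lambda>y. (- 2 * \<alpha> * ?E y) *\<^sub>R (y - p)) has_derivative
       (\<lambda>h. (4 * \<alpha>\<^sup>2 * ?E x * ((x - p) \<bullet> h)) *\<^sub>R (x - p) - (2 * \<alpha> * ?E x) *\<^sub>R h)) (at x)"
      by (rule derivative_eq_intros refl
          | simp add: inner_commute fun_eq_iff power2_eq_square algebra_simps)+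
    have "(\<Sum>b\<in>Basis. ((4 * \<alpha>\<^sup>2 * ?E x * ((x - p) \<bullet> b)) *\<^sub>R (x - p) - (2 * \<alpha> * ?E x) *\<^sub>R b) \<bullet> b)
      = (\<Sum>b\<in>Basis. 4 * \<alpha>\<^sup>2 * ?E x * (((x - p) \<bullet> b) * ((x - p) \<bullet> b)) - 2 * \<alpha> * ?E x * (b \<bullet> b))"
      by (simp only: inner_diff_left inner_scaleR_left mult.assoc)
    also have "\<dots> = 4 * \<alpha>\<^sup>2 * ?E x * ((x - p) \<bullet> (x - p)) - 2 * \<alpha> * ?E x * DIM('a)"
      by (subst euclidean_inner[of "x - p" "x - p"])
        (simp add: sum_subtractf flip: sum_distrib_left)
    finally show "(4 * \<alpha>\<^sup>2 * ((x - p) \<bullet> (x - p)) - 2 * \<alpha> * DIM('a)) * ?E x =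
      (\<Sum>b\<in>Basis. ((4 * \<alpha>\<^sup>2 * ?E x * ((x - p) \<bullet> b)) *\<^sub>R (x - p) - (2 * \<alpha> * ?E x) *\<^sub>R b) \<bullet> b)"
      by (simp add: algebra_simps)
  qed
qed

section \<open>Reflections in hyperplanes\<close>

definition hyp_reflect :: "'a::real_inner \<Rightarrow> real \<Rightarrow> 'a \<Rightarrow> 'a" where
  "hyp_reflect e l x = x + (2 * (l - x \<bullet> e)) *\<^sub>R e"

lemma hyp_reflect_inner: "norm e = 1 \<Longrightarrow> hyp_reflect e l x \<bullet> e = 2 * l - x \<bullet> e"
  by (simp add: hyp_reflect_def inner_add_left norm_eq_1 algebra_simps)

lemma hyp_reflect_involutive [simp]: "norm e = 1 \<Longrightarrow> hyp_reflect e l (hyp_reflect e l x) = x"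
  unfolding hyp_reflect_def[of e l "hyp_reflect e l x"] hyp_reflect_inner
  by (simp add: hyp_reflect_def algebra_simps flip: scaleR_add_left)

lemma has_derivative_hyp_reflect:
  "(hyp_reflect e l has_derivative (\<lambda>h. h - (2 * (h \<bullet> e)) *\<^sub>R e)) (at x)"
proof -
  have eq: "hyp_reflect e l = (\<lambda>x. x + (2 * (l - x \<bullet> e)) *\<^sub>R e)"
    by (simp add: hyp_reflect_def fun_eq_iff)
  show ?thesis
    unfolding eq by (rule derivative_eq_intros refl | simp)+
qed

text \<open>The linear part \<open>\<rho>\<close> of the reflection is symmetric and orthogonal, so
  the Hessian \<open>H\<close> becomes \<open>\<rho> H \<rho>\<close>, which has the same
  trace.\<close>

lemma has_laplacian_hyp_reflect:
  fixes e :: "'a::euclidean_space"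
  assumes "norm e = 1" and "has_laplacian v L (hyp_reflect e l x)"
  shows "has_laplacian (\<lambda>x. v (hyp_reflect e l x)) L x"
proof -
  obtain G H where
    G: "\<And>y. (v has_derivative (\<lambda>h. G y \<bullet> h)) (at y)"
      "(G has_derivative H) (at (hyp_reflect e l x))"
      "L = (\<Sum>b\<in>Basis. H b \<bullet> b)"
    using assms unfolding has_laplacian_def by blast
  define \<rho> where "\<rho> h = h - (2 * (h \<bullet> e)) *\<^sub>R e" for h
  have \<rho>: "(hyp_reflect e l has_derivative \<rho>) (at y)" for y
    using has_derivative_hyp_reflect unfolding \<rho>_def .
  have sym: "\<rho> a \<bullet> b = a \<bullet> \<rho> b" for a b
    by (simp add: \<rho>_def algebra_simps inner_commute)
  have blin: "bounded_linear \<rho>"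
    using \<rho> has_derivative_bounded_linear by blast
  have linH: "linear H"
    using G(2) has_derivative_bounded_linear bounded_linear.linear by blast
  show ?thesis
    unfolding has_laplacian_def
  proof (rule exI[of _ "\<lambda>y. \<rho> (G (hyp_reflect e l y))"], rule exI[of _ "\<lambda>h. \<rho> (H (\<rho> h))"],
      intro conjI allI)
    show "((\<lambda>x. v (hyp_reflect e l x)) has_derivative (\<lambda>h. \<rho> (G (hyp_reflect e l y)) \<bullet> h)) (at y)" for y
      using has_derivative_compose[OF \<rho> G(1)] by (simp add: sym)
    show "((\<lambda>y. \<rho> (G (hyp_reflect e l y))) has_derivative (\<lambda>h. \<rho> (H (\<rho> h)))) (at x)"
      using bounded_linear.has_derivative[OF blin has_derivative_compose[OF \<rho> G(2)]] .
    have ee: "e \<bullet> e = 1" using assms(1) by (simp add: norm_eq_1)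
    have He: "(\<Sum>b\<in>Basis. (b \<bullet> e) * (H b \<bullet> e)) = H e \<bullet> e"
    proof -
      have "H e = H (\<Sum>b\<in>Basis. (e \<bullet> b) *\<^sub>R b)" by (simp add: euclidean_representation)
      also have "\<dots> = (\<Sum>b\<in>Basis. (e \<bullet> b) *\<^sub>R H b)"
        by (simp add: linear_sum[OF linH] linear_scale[OF linH])
      finally show ?thesis by (simp add: inner_sum_left inner_commute[of e])
    qed
    \<comment> \<open>Expanding both factors \<open>\<rho>\<close> adds
      \<open>H e \<bullet> e\<close> with coefficients -2, -2 and 4 to the trace of
      \<open>H\<close>; they cancel because \<open>e\<close> is a unit vector.\<close>
    have "(\<Sum>b\<in>Basis. \<rho> (H (\<rho> b)) \<bullet> b) = (\<Sum>b\<in>Basis. H (\<rho> b) \<bullet> \<rho> b)"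
      by (simp add: sym)
    also have "\<dots> = (\<Sum>b\<in>Basis. H b \<bullet> b - 2 * ((b \<bullet> e) * (H b \<bullet> e)) - 2 * ((H e \<bullet> b) * (e \<bullet> b))
        + 4 * (H e \<bullet> e) * ((e \<bullet> b) * (e \<bullet> b)))"
      by (rule sum.cong) (simp_all add: \<rho>_def linear_diff[OF linH] linear_scale[OF linH]
          inner_commute algebra_simps)
    also have "\<dots> = L - 2 * (H e \<bullet> e) - 2 * (H e \<bullet> e) + 4 * (H e \<bullet> e) * (e \<bullet> e)"
      unfolding sum.distrib sum_subtractf G(3) sum_distrib_left[symmetric] He
        euclidean_inner[of "H e" e, symmetric] euclidean_inner[of e e, symmetric] ..
    finally show "L = (\<Sum>b\<in>Basis. \<rho> (H (\<rho> b)) \<bullet> b)" by (simp add: ee)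
  qed
qed

section \<open>Second derivative test\<close>

text \<open>If \<open>D\<close> were negative, \<open>\<phi>'\<close> would vanish at 0 and be
  negative just to the right of it, so \<open>\<phi>\<close> would drop below its minimum.\<close>

lemma DERIV2_nonneg_at_local_min:
  fixes \<phi> :: "real \<Rightarrow> real"
  assumes d1: "\<And>t. (\<phi> has_real_derivative \<phi>' t) (at t)"
    and d2: "(\<phi>' has_real_derivative D) (at 0)"
    and "\<delta> > 0" and min: "\<And>t. \<bar>t\<bar> < \<delta> \<Longrightarrow> \<phi> 0 \<le> \<phi> t"
  shows "0 \<le> D"
proof (rule ccontr)
  assume "\<not> 0 \<le> D"
  then have "D < 0" by simp
  have "\<phi>' 0 = 0"
    using DERIV_local_min[OF d1 \<open>\<delta> > 0\<close>] min by simp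
  obtain d where d: "d > 0" "\<And>h. h > 0 \<Longrightarrow> h < d \<Longrightarrow> \<phi>' h < 0"
    using DERIV_neg_dec_right[OF d2 \<open>D < 0\<close>] \<open>\<phi>' 0 = 0\<close> by auto
  define t where "t = min d \<delta> / 2"
  have t: "0 < t" "t < d" "t < \<delta>" using d(1) \<open>\<delta> > 0\<close> by (auto simp: t_def)
  have "\<phi> t < \<phi> 0"
  proof (rule DERIV_neg_imp_decreasing_open[OF t(1)])
    show "\<exists>y. (\<phi> has_real_derivative y) (at x) \<and> y < 0" if "0 < x" "x < t" for x
      using d1 d(2) that t by (meson less_trans)
    show "continuous_on {0..t} \<phi>"
      using d1 DERIV_isCont continuous_at_imp_continuous_on by blast
  qed
  with min[of t] t show False by simp
qed

text \<open>Restricting \<open>v\<close> to the coordinate lines through \<open>x\<close> shows that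
  every diagonal entry of the Hessian is nonnegative.\<close>

lemma laplacian_nonneg_at_local_min:
  fixes v :: "'a::euclidean_space \<Rightarrow> real"
  assumes "has_laplacian v L x" "open S" "x \<in> S" and min: "\<And>y. y \<in> S \<Longrightarrow> v x \<le> v y"
  shows "0 \<le> L"
proof -
  obtain G H where
    G: "\<And>y. (v has_derivative (\<lambda>h. G y \<bullet> h)) (at y)" "(G has_derivative H) (at x)"
      "L = (\<Sum>b\<in>Basis. H b \<bullet> b)"
    using assms(1) unfolding has_laplacian_def by blast
  have linH: "linear H"
    using G(2) has_derivative_bounded_linear bounded_linear.linear by blast
  obtain \<delta> where \<delta>: "\<delta> > 0" "ball x \<delta> \<subseteq> S"
    using assms(2,3) openE by blast
  have "0 \<le> H b \<bullet> b" if b: "b \<in> Basis" for b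
  proof (rule DERIV2_nonneg_at_local_min[OF _ _ \<delta>(1)])
    have line: "((\<lambda>t. x + t *\<^sub>R b) has_derivative (\<lambda>s. s *\<^sub>R b)) (at t)" for t
      by (rule derivative_eq_intros refl | simp)+
    show "((\<lambda>t. v (x + t *\<^sub>R b)) has_real_derivative G (x + t *\<^sub>R b) \<bullet> b) (at t)" for t
      using has_derivative_compose[OF line G(1), of t]
      by (simp add: has_field_derivative_def mult.commute[of _ "_ \<bullet> b"] fun_eq_iff)
    have "(G has_derivative H) (at (x + 0 *\<^sub>R b))" using G(2) by simp
    from has_derivative_inner_left[OF has_derivative_compose[OF line this], of b]
    show "((\<lambda>t. G (x + t *\<^sub>R b) \<bullet> b) has_real_derivative H b \<bullet> b) (at 0)"
      by (simp add: has_field_derivative_def linear_scale[OF linH] mult.commute[of _ "H b \<bullet> b"])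
    show "v (x + 0 *\<^sub>R b) \<le> v (x + t *\<^sub>R b)" if "\<bar>t\<bar> < \<delta>" for t
    proof -
      have "x + t *\<^sub>R b \<in> ball x \<delta>" using that b by (simp add: dist_norm)
      then show ?thesis using min \<delta> by auto
    qed
  qed
  then show ?thesis unfolding G(3) by (rule sum_nonneg)
qed

subsection \<open>Hopf lemma and strong minimum principle\<close>

text \<open>Compare \<open>w\<close> with a small multiple of a barrier \<open>h\<close> that
  vanishes on the sphere and satisfies the strict opposite inequality on the outer annulus. Then
  \<open>w - \<delta> * h\<close> is nonnegative on the ball and zero at \<open>x0\<close>, so the
  inward slope of \<open>w\<close> is at least that of \<open>\<delta> * h\<close>, which is
  positive.\<close>

lemma hopf_boundary_lemma:
  fixes w :: "'a::euclidean_space \<Rightarrow> real"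
  assumes lap: "\<And>x. has_laplacian w (L x) x"
    and ineq: "\<And>x. x \<in> ball p R \<Longrightarrow> L x \<le> K * w x"
    and pos: "\<And>x. x \<in> ball p R \<Longrightarrow> 0 < w x"
    and x0: "w x0 = 0" "dist p x0 = R" and "0 < R" and "0 \<le> K"
    and w': "(w has_derivative w') (at x0)"
  shows "0 < w' (p - x0)"
proof -
  \<comment> \<open>Large enough that the quadratic term of the Gaussian's Laplacian dominates both
    the dimension term and \<open>K\<close> as soon as the distance to \<open>p\<close> exceeds
    \<open>R / 2\<close>.\<close>
  define \<alpha> where "\<alpha> = 1 + (2 * DIM('a) + K + 1) / R\<^sup>2"
  have \<alpha>: "\<alpha> \<ge> 1" using \<open>0 \<le> K\<close> by (simp add: \<alpha>_def)
  have \<alpha>R: "2 * \<alpha> * DIM('a) + K < \<alpha>\<^sup>2 * R\<^sup>2"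
  proof -
    have "\<alpha> * R\<^sup>2 = R\<^sup>2 + (2 * DIM('a) + K + 1)"
      using \<open>0 < R\<close> by (simp add: \<alpha>_def field_simps)
    then have "\<alpha>\<^sup>2 * R\<^sup>2 = \<alpha> * (R\<^sup>2 + (2 * DIM('a) + K + 1))"
      by (simp add: power2_eq_square)
    moreover have "K \<le> \<alpha> * K" using \<alpha> \<open>0 \<le> K\<close> mult_right_mono[of 1 \<alpha> K] by simp
    moreover have "0 \<le> \<alpha> * R\<^sup>2" using \<alpha> by simp
    ultimately show ?thesis using \<alpha> unfolding distrib_left by linarith
  qed
  define h where "h x = exp (- \<alpha> * ((x - p) \<bullet> (x - p))) - exp (- \<alpha> * R\<^sup>2)" for x
  define Lh where
    "Lh x = (4 * \<alpha>\<^sup>2 * ((x - p) \<bullet> (x - p)) - 2 * \<alpha> * DIM('a)) * exp (- \<alpha> * ((x - p) \<bullet> (x - p)))"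
    for x
  have lap_h: "has_laplacian h (Lh x) x" for x
    using has_laplacian_diff[OF has_laplacian_gaussian has_laplacian_const]
    unfolding h_def Lh_def by simp
  have h_le: "h x \<le> 1" for x
  proof -
    have "exp (- \<alpha> * ((x - p) \<bullet> (x - p))) \<le> 1"
      using \<alpha> by simp
    then show ?thesis by (simp add: h_def add.commute less_imp_le trans_le_add2 diff_le_eq add_increasing2)
  qed
  have h_R: "h x = 0" if "dist p x = R" for x
    using that by (simp add: h_def dist_norm norm_minus_commute power2_norm_eq_inner[symmetric])
  have Lh_gt: "K * h x < Lh x" if "R / 2 < dist p x" for x
  proof -
    have "(R / 2)\<^sup>2 < (dist p x)\<^sup>2"
      using that \<open>0 < R\<close> by (intro power_strict_mono) auto
    also have "\<dots> = (x - p) \<bullet> (x - p)"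
      by (metis dist_commute dist_norm power2_norm_eq_inner)
    finally have "R\<^sup>2 < 4 * ((x - p) \<bullet> (x - p))"
      by (simp add: power_divide)
    then have "\<alpha>\<^sup>2 * R\<^sup>2 < \<alpha>\<^sup>2 * (4 * ((x - p) \<bullet> (x - p)))"
      using \<alpha> by (intro mult_strict_left_mono) auto
    with \<alpha>R have "K < 4 * \<alpha>\<^sup>2 * ((x - p) \<bullet> (x - p)) - 2 * \<alpha> * DIM('a)"
      by (simp add: algebra_simps)
    then have "K * exp (- \<alpha> * ((x - p) \<bullet> (x - p))) < Lh x"
      unfolding Lh_def by (intro mult_strict_right_mono) auto
    moreover have "K * h x \<le> K * exp (- \<alpha> * ((x - p) \<bullet> (x - p)))"
      unfolding h_def using \<open>0 \<le> K\<close> by (intro mult_left_mono) auto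
    ultimately show ?thesis by simp
  qed
  have cont_w: "continuous_on S w" and cont_h: "continuous_on S h" for S
    using lap lap_h has_laplacian_continuous_on by blast+
  have nonneg: "0 \<le> w x" if "x \<in> cball p R" for x
  proof -
    have "continuous_on (closure (ball p R)) w" by (rule cont_w)
    then show ?thesis
      using continuous_ge_on_closure[of "ball p R" w x 0] that pos \<open>0 < R\<close> by (auto intro: less_imp_le)
  qed
  \<comment> \<open>The minimum of \<open>w\<close> on the inner ball serves as
    \<open>\<delta>\<close>: since \<open>h \<le> 1\<close>, this gives
    \<open>\<delta> * h \<le> w\<close> there, so a negative minimum of \<open>q\<close> can only
    lie in the annulus.\<close>
  obtain x1 where x1: "x1 \<in> cball p (R/2)" "\<And>x. x \<in> cball p (R/2) \<Longrightarrow> w x1 \<le> w x"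
    using continuous_attains_inf[of "cball p (R/2)" w] cont_w \<open>0 < R\<close> by auto
  define \<delta> where "\<delta> = w x1"
  have "\<delta> > 0" unfolding \<delta>_def using x1(1) \<open>0 < R\<close> by (intro pos) auto
  define q where "q x = w x - \<delta> * h x" for x
  have lap_q: "has_laplacian q (L x - \<delta> * Lh x) x" for x
    unfolding q_def by (intro has_laplacian_diff has_laplacian_cmult lap lap_h)
  have cont_q: "continuous_on S q" for S
    using lap_q has_laplacian_continuous_on by blast
  have q_nonneg: "0 \<le> q x" if x: "x \<in> cball p R" for x
  proof -
    obtain m where m: "m \<in> cball p R" "\<And>x. x \<in> cball p R \<Longrightarrow> q m \<le> q x"
      using continuous_attains_inf[of "cball p R" q] cont_q \<open>0 < R\<close> by auto
    have "0 \<le> q m"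
    proof (rule ccontr)
      assume neg: "\<not> 0 \<le> q m"
      have "dist p m \<noteq> R"
        using neg h_R[of m] nonneg[OF m(1)] by (auto simp: q_def)
      moreover have "R / 2 < dist p m"
      proof (rule ccontr)
        assume "\<not> R / 2 < dist p m"
        then have "\<delta> \<le> w m" using x1(2)[of m] by (simp add: \<delta>_def)
        moreover have "\<delta> * h m \<le> \<delta>"
          using h_le[of m] \<open>\<delta> > 0\<close> by simp
        ultimately show False using neg by (simp add: q_def)
      qed
      ultimately have mR: "m \<in> ball p R" and Lhm: "K * h m < Lh m"
        using m(1) Lh_gt by auto
      \<comment> \<open>At a negative interior minimum \<open>w m < \<delta> * h m\<close>, hence
        \<open>L m \<le> K * \<delta> * h m < \<delta> * Lh m\<close>, against the second derivative
        test.\<close>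
      have "0 \<le> L m - \<delta> * Lh m"
        using laplacian_nonneg_at_local_min[OF lap_q open_ball mR] m(2) by auto
      moreover have "L m \<le> K * w m" using ineq[OF mR] .
      moreover have "K * w m \<le> K * (\<delta> * h m)"
        using neg \<open>0 \<le> K\<close> by (intro mult_left_mono) (auto simp: q_def)
      moreover have "\<delta> * (K * h m) < \<delta> * Lh m" using Lhm \<open>\<delta> > 0\<close> by simp
      ultimately show False by (simp add: algebra_simps)
    qed
    with m(2)[OF x] show ?thesis by simp
  qed
  define v where "v = p - x0"
  have v: "v \<bullet> v = R\<^sup>2"
    using x0(2) by (simp add: v_def dist_norm power2_norm_eq_inner[symmetric])
  have linw: "linear w'"
    using w' has_derivative_bounded_linear bounded_linear.linear by blast
  have "((\<lambda>t. x0 + t *\<^sub>R v) has_derivative (\<lambda>t. t *\<^sub>R v)) (at 0)"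
    by (rule derivative_eq_intros refl | simp)+
  from has_derivative_compose[OF this, of w w'] w'
  have dw: "((\<lambda>t. w (x0 + t *\<^sub>R v)) has_real_derivative w' v) (at 0)"
    by (simp add: has_field_derivative_def linear_scale[OF linw] mult.commute[of _ "w' v"])
  have h_line: "h (x0 + t *\<^sub>R v) = exp (- \<alpha> * ((1 - t)\<^sup>2 * R\<^sup>2)) - exp (- \<alpha> * R\<^sup>2)" for t
  proof -
    have "x0 + t *\<^sub>R v - p = (t - 1) *\<^sub>R v" by (simp add: v_def algebra_simps)
    then have "(x0 + t *\<^sub>R v - p) \<bullet> (x0 + t *\<^sub>R v - p) = (t - 1)\<^sup>2 * R\<^sup>2"
      by (simp add: v power2_eq_square del: inner_diff_right)
    then show ?thesis by (simp add: h_def power2_commute)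
  qed
  have dh: "((\<lambda>t. h (x0 + t *\<^sub>R v)) has_real_derivative 2 * \<alpha> * R\<^sup>2 * exp (- \<alpha> * R\<^sup>2)) (at 0)"
    unfolding h_line by (rule derivative_eq_intros refl | simp)+
  have dq: "((\<lambda>t. q (x0 + t *\<^sub>R v)) has_real_derivative
      w' v - \<delta> * (2 * \<alpha> * R\<^sup>2 * exp (- \<alpha> * R\<^sup>2))) (at 0)"
    unfolding q_def by (intro DERIV_diff dw DERIV_cmult dh)
  \<comment> \<open>A negative slope would make \<open>q\<close> negative just inside the ball on
    the segment from \<open>x0\<close> to \<open>p\<close>, although \<open>q x0 = 0\<close> and
    \<open>q\<close> is nonnegative on the ball.\<close>
  have "0 \<le> w' v - \<delta> * (2 * \<alpha> * R\<^sup>2 * exp (- \<alpha> * R\<^sup>2))"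
  proof (rule ccontr)
    assume "\<not> ?thesis"
    then obtain d where d: "d > 0" "\<And>s. s > 0 \<Longrightarrow> s < d \<Longrightarrow> q (x0 + (0 + s) *\<^sub>R v) < q (x0 + 0 *\<^sub>R v)"
      using DERIV_neg_dec_right[OF dq] by fastforce
    define s where "s = min d 1 / 2"
    have s: "0 < s" "s < d" "s < 1" using d(1) by (auto simp: s_def)
    have "p - (x0 + s *\<^sub>R v) = (1 - s) *\<^sub>R v" by (simp add: v_def algebra_simps)
    then have "dist p (x0 + s *\<^sub>R v) = (1 - s) * R"
      using s x0(2) by (simp add: dist_norm v_def)
    then have "x0 + s *\<^sub>R v \<in> cball p R"
      using s \<open>0 < R\<close> mult_right_mono[of "1 - s" 1 R] by simp
    then have "0 \<le> q (x0 + s *\<^sub>R v)" by (rule q_nonneg)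
    moreover have "q x0 = 0" using x0 h_R by (simp add: q_def)
    ultimately show False using d(2)[of s] s by simp
  qed
  moreover have "0 < \<delta> * (2 * \<alpha> * R\<^sup>2 * exp (- \<alpha> * R\<^sup>2))"
    using \<open>\<delta> > 0\<close> \<alpha> \<open>0 < R\<close> by simp
  ultimately show ?thesis unfolding v_def by linarith
qed

text \<open>The zero set is relatively closed in \<open>S\<close>; it is also open, so connectedness
  concludes. Otherwise some ball free of zeros would touch the zero set at a point of
  \<open>S\<close>, where the derivative vanishes by minimality but is nonzero by the Hopf
  lemma.\<close>

lemma strong_minimum_principle:
  fixes w :: "'a::euclidean_space \<Rightarrow> real"
  assumes lap: "\<And>x. has_laplacian w (L x) x"
    and "open S" "connected S"
    and ineq: "\<And>x. x \<in> S \<Longrightarrow> L x \<le> K * w x" and "0 \<le> K"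
    and nonneg: "\<And>x. x \<in> S \<Longrightarrow> 0 \<le> w x"
    and a: "a \<in> S" "w a = 0" and b: "b \<in> S"
  shows "w b = 0"
proof -
  have cont: "continuous_on A w" for A
    using lap has_laplacian_continuous_on by blast
  define Z where "Z = {x \<in> S. w x = 0}"
  have "\<exists>r>0. ball x r \<subseteq> Z" if x: "x \<in> Z" for x
  proof -
    obtain r where r: "r > 0" "ball x r \<subseteq> S"
      using x \<open>open S\<close> unfolding Z_def by (auto elim: openE)
    \<comment> \<open>With half the radius, every ball around \<open>q\<close> reaching no further
      than \<open>x\<close> stays inside \<open>ball x r\<close>. The zero \<open>x0\<close> nearest
      to \<open>q\<close> is the touching point.\<close>
    have "w q = 0" if q: "q \<in> ball x (r/2)" for q
    proof (rule ccontr)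
      assume "w q \<noteq> 0"
      have "closed (w -` {0})"
        using cont[of UNIV] by (simp add: continuous_closed_vimage continuous_on_eq_continuous_at)
      then have "compact (cball q (dist q x) \<inter> w -` {0})" by (simp add: compact_Int_closed)
      moreover have "x \<in> cball q (dist q x) \<inter> w -` {0}"
        using x by (simp add: Z_def)
      moreover have "continuous_on (cball q (dist q x) \<inter> w -` {0}) (dist q)"
        by (intro continuous_intros)
      ultimately obtain x0 where "x0 \<in> cball q (dist q x) \<inter> w -` {0}"
        and "\<forall>y \<in> cball q (dist q x) \<inter> w -` {0}. dist q x0 \<le> dist q y"
        using continuous_attains_inf by (metis empty_iff)
      then have x0: "dist q x0 \<le> dist q x" "w x0 = 0"
        and near: "\<And>y. dist q y \<le> dist q x \<Longrightarrow> w y = 0 \<Longrightarrow> dist q x0 \<le> dist q y"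
        by auto
      have sub: "cball q (dist q x0) \<subseteq> S"
      proof
        fix y assume "y \<in> cball q (dist q x0)"
        then have "dist x y < r"
          using x0(1) q dist_triangle[of x y q] by (simp add: dist_commute)
        then show "y \<in> S" using r by auto
      qed
      have "0 < dist q x0" using x0 \<open>w q \<noteq> 0\<close> by auto
      have pos: "0 < w y" if "y \<in> ball q (dist q x0)" for y
      proof -
        have "y \<in> S" using that sub by auto
        moreover have "w y \<noteq> 0" using that near[of y] x0(1) by auto
        ultimately show ?thesis using nonneg[of y] by simp
      qed
      have "x0 \<in> S" using sub by auto
      obtain w' where w': "(w has_derivative w') (at x0)"
        using lap has_laplacian_differentiable unfolding differentiable_def by blast
      have "w' = (\<lambda>v. 0)"
        using differential_zero_maxmin[OF \<open>x0 \<in> S\<close> \<open>open S\<close> w'] nonneg x0(2) by auto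
      moreover have "0 < w' (q - x0)"
        by (rule hopf_boundary_lemma[OF lap _ pos x0(2) refl \<open>0 < dist q x0\<close> \<open>0 \<le> K\<close> w'])
          (auto intro!: ineq subsetD[OF sub])
      ultimately show False by simp
    qed
    moreover have "ball x (r/2) \<subseteq> S" using r by (auto intro: subset_ball)
    ultimately show ?thesis using r(1) by (intro exI[of _ "r/2"]) (auto simp: Z_def)
  qed
  then have "open Z" unfolding open_contains_ball by blast
  moreover have "open (S - Z)"
  proof -
    have "S - Z = S \<inter> w -` (- {0})" by (auto simp: Z_def)
    then show ?thesis
      using continuous_open_preimage[OF cont \<open>open S\<close>, of "- {0}"] by auto
  qed
  ultimately have "S - Z = {}"
    using connectedD[OF \<open>connected S\<close>, of Z "S - Z"] a by (auto simp: Z_def)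
  with b show ?thesis by (auto simp: Z_def)
qed

subsection \<open>Moving planes\<close>

definition z_direction :: "'n::finite set \<Rightarrow> real ^ 'n \<Rightarrow> bool" where
  "z_direction Y e \<longleftrightarrow> norm e = 1 \<and> (\<forall>i\<in>Y. e $ i = 0)"

lemma z_direction_norm: "z_direction Y e \<Longrightarrow> norm e = 1"
  by (simp add: z_direction_def)

lemma z_direction_inner_y:
  assumes "z_direction Y e" "\<And>i. i \<notin> Y \<Longrightarrow> s $ i = 0"
  shows "s \<bullet> e = 0"
proof -
  have "s $ i * e $ i = 0" for i
    using assms by (cases "i \<in> Y") (auto simp: z_direction_def)
  then show ?thesis by (simp only: inner_vec_def inner_real_def sum.neutral_const)
qed

text \<open>Lets the decay in \<open>z\<close> act on half-spaces: a large
  \<open>x \<bullet> e\<close> forces a large \<open>z\<close> part.\<close>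

lemma abs_inner_z_direction_le:
  assumes "z_direction Y e"
  shows "\<bar>x \<bullet> e\<bar> \<le> norm (z_part Y x)"
proof -
  have "x \<bullet> e = z_part Y x \<bullet> e"
    unfolding inner_vec_def
    by (rule sum.cong) (use assms in \<open>auto simp: z_direction_def z_part_def\<close>)
  also have "\<bar>\<dots>\<bar> \<le> norm (z_part Y x) * norm e" by (rule Cauchy_Schwarz_ineq2)
  finally show ?thesis using assms by (simp add: z_direction_def)
qed

lemma inner_sum_diff:
  fixes a b :: "'a::real_inner"
  assumes "a \<bullet> a = b \<bullet> b"
  shows "(a + b) \<bullet> (a - b) = 0"
  using assms by (simp add: algebra_simps inner_commute)

text \<open>The ingredients of the moving plane argument: \<open>G\<close> is the gradient of
  \<open>u\<close>, \<open>K\<close> is a Lipschitz constant of \<open>f\<close> on the range of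
  \<open>u\<close>, and the sign of \<open>f'\<close> near 0 enters as monotonicity.\<close>

locale decaying_solution =
  fixes Y :: "'n::finite set" and f :: "real \<Rightarrow> real"
    and u :: "real ^ 'n \<Rightarrow> real" and G :: "real ^ 'n \<Rightarrow> real ^ 'n" and K \<epsilon> :: real
  assumes gradient: "(u has_derivative (\<lambda>h. G x \<bullet> h)) (at x)"
    and continuous_gradient: "continuous_on UNIV G"
    and equation: "has_laplacian u (- f (u x)) x"
    and pos: "0 < u x"
    and lipschitz: "\<bar>f (u x) - f (u y)\<bar> \<le> K * \<bar>u x - u y\<bar>" and K: "0 \<le> K"
    and eps: "0 < \<epsilon>"
    and antimono: "\<lbrakk>0 < a; a \<le> b; b < \<epsilon>\<rbrakk> \<Longrightarrow> f b \<le> f a"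
    and periodic: "periodic_in_y Y u"
    and decay: "vanishes_uniformly_in_y Y u"
begin

section \<open>Decay and compactness modulo periods\<close>

lemma continuous_on_u: "continuous_on S u"
  using equation has_laplacian_continuous_on by blast

lemma decayE:
  assumes "0 < c"
  obtains R where "\<And>x. R < norm (z_part Y x) \<Longrightarrow> u x < c"
proof -
  obtain R where "\<forall>x. norm (z_part Y x) > R \<longrightarrow> \<bar>u x\<bar> < c"
    using decay assms unfolding vanishes_uniformly_in_y_def by blast
  then show ?thesis using pos that by (metis abs_of_pos)
qed

text \<open>Single periods are iterated by induction over the integers and then combined by
  induction over the set of coordinates.\<close>

lemma period_lattice:
  "\<exists>T :: real ^ 'n. (\<forall>j\<in>Y. 0 < T $ j) \<and>
     (\<forall>(k :: 'n \<Rightarrow> int) x. u (x + (\<chi> j. if j \<in> Y then of_int (k j) * T $ j else 0)) = u x)"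
proof -
  obtain T :: "real ^ 'n" where T: "\<And>j. j \<in> Y \<Longrightarrow> 0 < T $ j"
    and per: "\<And>j x. j \<in> Y \<Longrightarrow> u (x + T $ j *\<^sub>R axis j 1) = u x"
    using periodic unfolding periodic_in_y_def by blast
  have int: "u (x + (of_int m * T $ j) *\<^sub>R axis j 1) = u x" if j: "j \<in> Y" for j x and m :: int
  proof (induction m arbitrary: x rule: int_induct[where k = 0])
    case (step1 i)
    then show ?case using per[OF j, of "x + (of_int i * T $ j) *\<^sub>R axis j 1"]
      by (simp add: algebra_simps)
  next
    case (step2 i)
    then show ?case using per[OF j, of "x + (of_int (i - 1) * T $ j) *\<^sub>R axis j 1"]
      by (simp add: algebra_simps)
  qed simp
  have shift: "u (x + (\<Sum>j\<in>S. (of_int (k j) * T $ j) *\<^sub>R axis j 1)) = u x" if "S \<subseteq> Y"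
    for S x and k :: "'n \<Rightarrow> int"
    using finite[of S] that
  proof (induction S arbitrary: x rule: finite_induct)
    case (insert j S)
    then show ?case
      using int[of j "x + (\<Sum>j\<in>S. (of_int (k j) * T $ j) *\<^sub>R axis j 1)" "k j"]
      by (simp add: algebra_simps)
  qed simp
  have "(\<chi> j. if j \<in> Y then of_int (k j) * T $ j else 0) =
      (\<Sum>j\<in>Y. (of_int (k j) * T $ j) *\<^sub>R axis j 1)" for k :: "'n \<Rightarrow> int"
    by (simp add: vec_eq_iff axis_def if_distrib[of "\<lambda>a. _ * a"] sum.delta' cong: if_cong)
  then have "u (x + (\<chi> j. if j \<in> Y then of_int (k j) * T $ j else 0)) = u x"
    for k :: "'n \<Rightarrow> int" and x
    by (simp only: shift[OF order_refl])
  then show ?thesis using T by blast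
qed

text \<open>Replaces compactness in the unbounded \<open>y\<close> variables: \<open>C R\<close> is
  one period cell in \<open>y\<close> times a cube in \<open>z\<close>, and a lattice translation
  brings every point with \<open>z\<close> part of norm at most \<open>R\<close> into it.\<close>

lemma compact_cells:
  "\<exists>C :: real \<Rightarrow> (real ^ 'n) set. (\<forall>R. compact (C R)) \<and>
     (\<forall>R x. norm (z_part Y x) \<le> R \<longrightarrow>
        (\<exists>s. (\<forall>i. i \<notin> Y \<longrightarrow> s $ i = 0) \<and> (\<forall>y. u (y + s) = u y) \<and> x + s \<in> C R))"
proof -
  obtain T :: "real ^ 'n" where T: "\<And>j. j \<in> Y \<Longrightarrow> 0 < T $ j"
    and per: "\<And>(k :: 'n \<Rightarrow> int) x.
        u (x + (\<chi> j. if j \<in> Y then of_int (k j) * T $ j else 0)) = u x"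
    using period_lattice by metis
  define C where
    "C R = cbox (\<chi> i. if i \<in> Y then 0 else - R) (\<chi> i. if i \<in> Y then T $ i else R)" for R
  have "\<exists>s. (\<forall>i. i \<notin> Y \<longrightarrow> s $ i = 0) \<and> (\<forall>y. u (y + s) = u y) \<and> x + s \<in> C R"
    if R: "norm (z_part Y x) \<le> R" for R x
  proof (intro exI conjI allI impI)
    \<comment> \<open>Removing the whole periods moves coordinate \<open>j\<close> into the interval
      from 0 to \<open>T $ j\<close>.\<close>
    let ?k = "\<lambda>j. - \<lfloor>x $ j / T $ j\<rfloor>"
    let ?s = "\<chi> j. if j \<in> Y then of_int (?k j) * T $ j else 0"
    show "u (y + ?s) = u y" for y by (rule per)
    show "?s $ i = 0" if "i \<notin> Y" for i using that by simp
    have "0 \<le> x $ i + of_int (?k i) * T $ i \<and> x $ i + of_int (?k i) * T $ i \<le> T $ i"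
      if "i \<in> Y" for i
    proof -
      have "of_int \<lfloor>x $ i / T $ i\<rfloor> \<le> x $ i / T $ i" "x $ i / T $ i \<le> of_int \<lfloor>x $ i / T $ i\<rfloor> + 1"
        by linarith+
      then have "of_int \<lfloor>x $ i / T $ i\<rfloor> * T $ i \<le> x $ i"
        "x $ i \<le> (of_int \<lfloor>x $ i / T $ i\<rfloor> + 1) * T $ i"
        using T[OF that] by (simp_all only: pos_le_divide_eq pos_divide_le_eq)
      then show ?thesis by (simp add: algebra_simps)
    qed
    moreover have "\<bar>x $ i\<bar> \<le> R" if "i \<notin> Y" for i
      using component_le_norm_cart[of "z_part Y x" i] R that by (simp add: z_part_def)
    ultimately show "x + ?s \<in> C R"
      unfolding C_def mem_box_cart by (force simp: abs_le_iff)
  qed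
  moreover have "compact (C R)" for R by (simp add: C_def)
  ultimately show ?thesis by blast
qed

section \<open>Differences with the reflected solution\<close>

text \<open>The function \<open>w\<close> of the overview, taken on the whole space. For a unit
  vector \<open>e\<close> it is odd under the reflection, so the side
  \<open>l \<le> x \<bullet> e\<close> carries all the information.\<close>

definition reflection_diff :: "real ^ 'n \<Rightarrow> real \<Rightarrow> real ^ 'n \<Rightarrow> real" where
  "reflection_diff e l x = u (hyp_reflect e l x) - u x"

lemma reflection_diff_shift:
  assumes "z_direction Y e" "\<And>i. i \<notin> Y \<Longrightarrow> s $ i = 0" "\<And>y. u (y + s) = u y"
  shows "reflection_diff e l (x + s) = reflection_diff e l x"
proof -
  have "hyp_reflect e l (x + s) = hyp_reflect e l x + s"
    using z_direction_inner_y[OF assms(1,2)]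
    by (simp add: hyp_reflect_def inner_add_left)
  then show ?thesis by (simp add: reflection_diff_def assms(3))
qed

lemma reflection_diff_boundary: "x \<bullet> e = l \<Longrightarrow> reflection_diff e l x = 0"
  by (simp add: reflection_diff_def hyp_reflect_def)

lemma laplacian_reflection_diff:
  assumes "norm e = 1"
  shows "has_laplacian (reflection_diff e l) (f (u x) - f (u (hyp_reflect e l x))) x"
proof -
  have "has_laplacian (reflection_diff e l) (- f (u (hyp_reflect e l x)) - (- f (u x))) x"
    unfolding reflection_diff_def
    by (intro has_laplacian_diff has_laplacian_hyp_reflect assms equation)
  then show ?thesis by simp
qed

lemma continuous_on_reflection_diff:
  assumes "norm e = 1"
  shows "continuous_on S (reflection_diff e l)"
  using laplacian_reflection_diff[OF assms] has_laplacian_continuous_on by blast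

text \<open>Dividing by \<open>g\<close>, which is strictly superharmonic with values in \<open>[1, 2)\<close> on the half-space,
  makes the inequality at the minimum strict, so that only the second derivative test is needed.\<close>

lemma negative_reflection_diff_large_value:
  assumes e: "z_direction Y e" and x1: "l \<le> x1 \<bullet> e" "reflection_diff e l x1 < 0"
  shows "\<exists>x. l < x \<bullet> e \<and> reflection_diff e l x < 0 \<and> \<epsilon> \<le> u x"
proof -
  note ne = z_direction_norm[OF e]
  define g where "g x = 2 - exp (l - x \<bullet> e)" for x
  have g1: "1 \<le> g x" if "l \<le> x \<bullet> e" for x using that by (simp add: g_def)
  have lap_g: "has_laplacian g (- exp (l - x \<bullet> e)) x" for x
    using has_laplacian_diff[OF has_laplacian_const has_laplacian_exp_linear, of 2 l e x] ne
    unfolding g_def by (simp add: norm_eq_1)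
  define v where "v x = reflection_diff e l x / g x" for x
  define c where "c = - v x1"
  have "0 < c"
    using x1 g1[OF x1(1)] by (simp add: c_def v_def divide_neg_pos)
  \<comment> \<open>On the half-space \<open>v \<ge> - u\<close>, so beyond \<open>R\<close> the
    quotient stays above \<open>- c = v x1\<close>. Its minimum can therefore be sought in a compact
    cell.\<close>
  obtain R where R: "\<And>x. R < norm (z_part Y x) \<Longrightarrow> u x < c" using decayE[OF \<open>0 < c\<close>] by blast
  obtain C where C: "compact (C R)" and cell: "\<And>x. norm (z_part Y x) \<le> R \<Longrightarrow>
      \<exists>s. (\<forall>i. i \<notin> Y \<longrightarrow> s $ i = 0) \<and> (\<forall>y. u (y + s) = u y) \<and> x + s \<in> C R"
    using compact_cells by metis
  define D where "D = C R \<inter> {x. l \<le> x \<bullet> e}"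
  have "compact D"
    unfolding D_def inner_commute[of _ e] by (intro compact_Int_closed C closed_halfspace_ge)
  have D_rep: "\<exists>x'\<in>D. v x' = v x" if R: "norm (z_part Y x) \<le> R" and "l \<le> x \<bullet> e" for x
  proof -
    obtain s where s: "\<And>i. i \<notin> Y \<Longrightarrow> s $ i = 0" "\<And>y. u (y + s) = u y" "x + s \<in> C R"
      using cell[OF R] by blast
    have "(x + s) \<bullet> e = x \<bullet> e"
      using z_direction_inner_y[OF e s(1)] by (simp add: inner_add_left)
    then show ?thesis
      using that s reflection_diff_shift[OF e s(1,2)]
      by (intro bexI[of _ "x + s"]) (auto simp: D_def v_def g_def)
  qed
  have v_far: "- c < v x" if "R < norm (z_part Y x)" "l \<le> x \<bullet> e" for x
  proof -
    have "- c < - u x" using R[OF that(1)] by simp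
    also have "\<dots> \<le> - u x / g x"
      using g1[OF that(2)] pos[of x] by (simp add: divide_simps)
    also have "\<dots> \<le> v x"
      unfolding v_def using g1[OF that(2)] pos[of "hyp_reflect e l x"]
      by (intro divide_right_mono) (auto simp: reflection_diff_def)
    finally show ?thesis .
  qed
  have "norm (z_part Y x1) \<le> R"
    using v_far[of x1] x1 by (force simp: c_def)
  from D_rep[OF this x1(1)] obtain x1' where x1': "x1' \<in> D" "v x1' = - c"
    by (auto simp: c_def)
  have "continuous_on D v"
    unfolding v_def using g1 lap_g
    by (intro continuous_on_divide continuous_on_reflection_diff ne)
      (force simp: D_def intro: has_laplacian_continuous_on)+
  then obtain x0 where x0: "x0 \<in> D" "\<And>x. x \<in> D \<Longrightarrow> v x0 \<le> v x"
    using continuous_attains_inf[OF \<open>compact D\<close>, of v] x1'(1) by blast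
  define m where "m = - v x0"
  have "0 < m" using x0(2)[OF x1'(1)] x1'(2) \<open>0 < c\<close> by (simp add: m_def)
  have min: "v x0 \<le> v x" if "l \<le> x \<bullet> e" for x
  proof (cases "R < norm (z_part Y x)")
    case True
    then show ?thesis using v_far[OF _ that] x0(2)[OF x1'(1)] x1'(2) by simp
  next
    case False
    then show ?thesis using D_rep[OF _ that] x0(2) by force
  qed
  have lx0: "l \<le> x0 \<bullet> e" using x0(1) by (simp add: D_def)
  have wx0: "reflection_diff e l x0 = - m * g x0"
    using g1[OF lx0] by (simp add: m_def v_def)
  have neg: "reflection_diff e l x0 < 0"
    unfolding wx0 using \<open>0 < m\<close> g1[OF lx0] by simp
  have inner: "l < x0 \<bullet> e"
    using neg lx0 reflection_diff_boundary[of x0 e l] by fastforce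
  \<comment> \<open>As \<open>v \<ge> - m\<close> on the half-space, \<open>q\<close> is nonnegative
    there and vanishes at \<open>x0\<close>. If \<open>u x0 < \<epsilon>\<close>, monotonicity of
    \<open>f\<close> and the strict superharmonicity of \<open>g\<close> make its Laplacian negative
    at this minimum.\<close>
  define q where "q x = reflection_diff e l x + m * g x" for x
  have "\<epsilon> \<le> u x0"
  proof (rule ccontr)
    assume "\<not> \<epsilon> \<le> u x0"
    then have "f (u x0) \<le> f (u (hyp_reflect e l x0))"
      using neg pos by (intro antimono) (auto simp: reflection_diff_def)
    moreover have "has_laplacian q
        (f (u x0) - f (u (hyp_reflect e l x0)) + m * - exp (l - x0 \<bullet> e)) x0"
      unfolding q_def by (intro has_laplacian_add has_laplacian_cmult laplacian_reflection_diff ne lap_g)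
    then have "0 \<le> f (u x0) - f (u (hyp_reflect e l x0)) + m * - exp (l - x0 \<bullet> e)"
    proof (rule laplacian_nonneg_at_local_min)
      show "open {x. l < x \<bullet> e}" unfolding inner_commute[of _ e] by (rule open_halfspace_gt)
      show "x0 \<in> {x. l < x \<bullet> e}" using inner by simp
      show "q x0 \<le> q y" if "y \<in> {x. l < x \<bullet> e}" for y
        using min[of y] g1[of y] that by (simp add: q_def wx0) (simp add: v_def m_def field_simps)
    qed
    moreover have "0 < m * exp (l - x0 \<bullet> e)" using \<open>0 < m\<close> by simp
    ultimately show False by simp
  qed
  with inner neg show ?thesis by blast
qed

text \<open>Beyond a radius given by decay, and uniform in the direction,
  \<open>u < \<epsilon>\<close>; a negative difference would produce a point there with
  \<open>u \<ge> \<epsilon>\<close>.\<close>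

lemma reflection_diff_nonneg_far:
  "\<exists>R. \<forall>e l x. z_direction Y e \<longrightarrow> R < l \<longrightarrow> l \<le> x \<bullet> e \<longrightarrow> 0 \<le> reflection_diff e l x"
proof -
  obtain R where R: "\<And>x. R < norm (z_part Y x) \<Longrightarrow> u x < \<epsilon>" using decayE[OF eps] by blast
  have "0 \<le> reflection_diff e l x" if e: "z_direction Y e" and l: "R < l" "l \<le> x \<bullet> e" for e l x
  proof (rule ccontr)
    assume "\<not> ?thesis"
    then obtain y where y: "l < y \<bullet> e" "\<epsilon> \<le> u y"
      using negative_reflection_diff_large_value[OF e l(2)] by force
    have "R < norm (z_part Y y)" using abs_inner_z_direction_le[OF e, of y] y l by linarith
    with R y show False by force
  qed
  then show ?thesis by blast
qed

text \<open>Where the difference \<open>w\<close> is nonnegative, the Lipschitz bound turns its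
  equation into Laplacian at most \<open>K * w\<close>. A zero inside the half-space then spreads by
  the strong minimum principle; without one, the Hopf lemma applies at the hyperplane.\<close>

lemma reflection_diff_dichotomy:
  assumes e: "z_direction Y e" and nonneg: "\<And>x. l \<le> x \<bullet> e \<Longrightarrow> 0 \<le> reflection_diff e l x"
  shows "(\<forall>x. reflection_diff e l x = 0) \<or>
    ((\<forall>x. l < x \<bullet> e \<longrightarrow> 0 < reflection_diff e l x) \<and> (\<forall>x. x \<bullet> e = l \<longrightarrow> G x \<bullet> e < 0))"
proof (cases "\<exists>a. l < a \<bullet> e \<and> reflection_diff e l a = 0")
  case True
  then obtain a where a: "l < a \<bullet> e" "reflection_diff e l a = 0" by blast
  note ne = z_direction_norm[OF e]
  define S where "S = {x. l < x \<bullet> e}"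
  have S: "open S" "connected S"
    unfolding S_def inner_commute[of _ e]
    by (auto intro: open_halfspace_gt convex_connected convex_halfspace_gt)
  have ineq: "f (u x) - f (u (hyp_reflect e l x)) \<le> K * reflection_diff e l x" if "x \<in> S" for x
    using lipschitz[of x "hyp_reflect e l x"] nonneg[of x] that
    by (simp add: S_def reflection_diff_def abs_minus_commute)
  have zero: "reflection_diff e l x = 0" if "l < x \<bullet> e" for x
    by (rule strong_minimum_principle[OF laplacian_reflection_diff[OF ne] S ineq K, of a])
      (use a nonneg that in \<open>auto simp: S_def\<close>)
  have "reflection_diff e l x = 0" for x
  proof -
    \<comment> \<open>The opposite half-space reduces to the first one because the difference
      changes sign under the reflection.\<close>
    consider "l < x \<bullet> e" | "x \<bullet> e = l" | "l < hyp_reflect e l x \<bullet> e"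
      using hyp_reflect_inner[OF ne, of l x] by linarith
    then show ?thesis
      using zero[of x] zero[of "hyp_reflect e l x"] reflection_diff_boundary ne
      by cases (auto simp: reflection_diff_def)
  qed
  then show ?thesis by blast
next
  case False
  note ne = z_direction_norm[OF e]
  have pos': "0 < reflection_diff e l x" if "l < x \<bullet> e" for x
    using False nonneg[of x] that by (metis less_eq_real_def)
  have "G x \<bullet> e < 0" if x: "x \<bullet> e = l" for x
  proof -
    have refl: "hyp_reflect e l x = x" using x by (simp add: hyp_reflect_def)
    have ball: "l < y \<bullet> e" if "y \<in> ball (x + e) 1" for y
    proof -
      have "(x + e - y) \<bullet> e \<le> norm (x + e - y) * norm e" by (rule norm_cauchy_schwarz)
      then show ?thesis using that ne x
        by (simp add: dist_norm inner_diff_left inner_add_left norm_eq_1)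
    qed
    have "(u has_derivative (\<lambda>h. G x \<bullet> h)) (at (hyp_reflect e l x))"
      using gradient[of x] by (simp add: refl)
    from has_derivative_diff[OF has_derivative_compose[OF has_derivative_hyp_reflect this] gradient]
    have deriv: "(reflection_diff e l has_derivative
        (\<lambda>h. G x \<bullet> (h - (2 * (h \<bullet> e)) *\<^sub>R e) - G x \<bullet> h)) (at x)"
      unfolding reflection_diff_def .
    have ineq: "f (u y) - f (u (hyp_reflect e l y)) \<le> K * reflection_diff e l y"
      if "y \<in> ball (x + e) 1" for y
      using lipschitz[of y "hyp_reflect e l y"] pos'[OF ball[OF that]]
      by (simp add: reflection_diff_def abs_minus_commute)
    \<comment> \<open>The unit ball around \<open>x + e\<close> touches the hyperplane at
      \<open>x\<close>; the inward derivative of the difference there is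
      \<open>- 2 * (G x \<bullet> e)\<close>.\<close>
    have "0 < G x \<bullet> (e - (2 * (e \<bullet> e)) *\<^sub>R e) - G x \<bullet> e"
      using hopf_boundary_lemma[where p = "x + e" and R = 1, OF laplacian_reflection_diff[OF ne] ineq
          pos'[OF ball] reflection_diff_boundary[OF x] _ _ K deriv] ne
      by (simp add: dist_norm)
    then show ?thesis using ne by (simp add: norm_eq_1 inner_diff_right)
  qed
  with pos' show ?thesis by blast
qed

section \<open>Uniqueness of symmetry planes\<close>

text \<open>Iterating the translation would carry the positive value \<open>u 0\<close> to points
  with arbitrarily large \<open>z\<close> part.\<close>

lemma no_translation_invariance:
  assumes s: "\<And>i. i \<in> Y \<Longrightarrow> s $ i = 0" and inv: "\<And>x. u (x + s) = u x"
  shows "s = 0"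
proof (rule ccontr)
  assume "s \<noteq> 0"
  have z: "z_part Y s = s" using s by (auto simp: z_part_def vec_eq_iff)
  have iter: "u (of_nat k *\<^sub>R s) = u 0" for k :: nat
  proof (induction k)
    case (Suc k)
    then show ?case using inv[of "of_nat k *\<^sub>R s"] by (simp add: algebra_simps)
  qed simp
  obtain R where R: "\<And>x. R < norm (z_part Y x) \<Longrightarrow> u x < u 0" using decayE[OF pos] by blast
  obtain k :: nat where "R < of_nat k * norm s"
    using reals_Archimedean3[of "norm s"] \<open>s \<noteq> 0\<close> by auto
  moreover have "z_part Y (of_nat k *\<^sub>R s) = of_nat k *\<^sub>R s"
    using s by (simp add: z_part_def vec_eq_iff)
  ultimately show False using R[of "of_nat k *\<^sub>R s"] iter by simp
qed

text \<open>Composing the two reflections gives the translation by \<open>2 * (l' - l)\<close> along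
  \<open>e\<close>, which must be trivial.\<close>

lemma symmetry_plane_unique:
  assumes e: "z_direction Y e"
    and "\<And>x. reflection_diff e l x = 0" "\<And>x. reflection_diff e l' x = 0"
  shows "l = l'"
proof -
  note ne = z_direction_norm[OF e]
  have eq: "hyp_reflect e l' (hyp_reflect e l x) = x + (2 * (l' - l)) *\<^sub>R e" for x
    unfolding hyp_reflect_def[of e l' "hyp_reflect e l x"] hyp_reflect_inner[OF ne]
    by (simp add: hyp_reflect_def vec_eq_iff algebra_simps)
  have "u (x + (2 * (l' - l)) *\<^sub>R e) = u x" for x
    using assms(2)[of x] assms(3)[of "hyp_reflect e l x"] by (simp add: reflection_diff_def eq)
  then have "(2 * (l' - l)) *\<^sub>R e = 0"
    using e by (intro no_translation_invariance) (auto simp: z_direction_def)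
  with ne show ?thesis by auto
qed

text \<open>Reflecting the origin far away lands where \<open>u < u 0\<close>. This bounds the
  admissible plane positions from below.\<close>

lemma reflection_diff_negative_at_origin:
  "\<exists>l\<le>0. reflection_diff e l 0 < 0" if e: "z_direction Y e"
proof -
  obtain R where R: "\<And>x. R < norm (z_part Y x) \<Longrightarrow> u x < u 0" using decayE[OF pos] by blast
  define l where "l = - \<bar>R\<bar> - 1"
  have "hyp_reflect e l 0 \<bullet> e = 2 * l" using hyp_reflect_inner[OF z_direction_norm[OF e]] by simp
  then have "R < norm (z_part Y (hyp_reflect e l 0))"
    using abs_inner_z_direction_le[OF e, of "hyp_reflect e l 0"] by (simp add: l_def)
  then moreover have "l \<le> 0" by (simp add: l_def)
  ultimately show ?thesis using R by (force simp: reflection_diff_def)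
qed

section \<open>The critical position\<close>

text \<open>By the mean value theorem, \<open>G\<close> has nonnegative component along
  \<open>e\<close> somewhere between \<open>X k\<close> and its mirror image. These segments shrink
  to \<open>x\<close>, so continuity of the gradient passes this to the limit.\<close>

lemma gradient_limit_nonneg:
  assumes e: "z_direction Y e" and lim: "\<mu> \<longlonglongrightarrow> l" "X \<longlonglongrightarrow> x" and x: "x \<bullet> e = l"
    and above: "\<And>k. \<mu> k < X k \<bullet> e" and neg: "\<And>k. reflection_diff e (\<mu> k) (X k) < 0"
  shows "0 \<le> G x \<bullet> e"
proof -
  have "\<exists>t. 0 < t \<and> t < 1 \<and> 0 \<le> G (X k + (t * (2 * (\<mu> k - X k \<bullet> e))) *\<^sub>R e) \<bullet> e" for k
  proof -
    define c where "c = 2 * (\<mu> k - X k \<bullet> e)"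
    have "c < 0" using above[of k] by (simp add: c_def)
    have line: "((\<lambda>t. X k + (t * c) *\<^sub>R e) has_derivative (\<lambda>s. (s * c) *\<^sub>R e)) (at t)" for t
      by (rule derivative_eq_intros refl | simp)+
    have d: "((\<lambda>t. u (X k + (t * c) *\<^sub>R e)) has_real_derivative
        c * (G (X k + (t * c) *\<^sub>R e) \<bullet> e)) (at t)" for t
    proof -
      have "(\<lambda>s. G (X k + (t * c) *\<^sub>R e) \<bullet> (s * c) *\<^sub>R e) = (*) (c * (G (X k + (t * c) *\<^sub>R e) \<bullet> e))"
        by (intro ext) simp
      with has_derivative_compose[OF line gradient, of t] show ?thesis
        by (simp only: has_field_derivative_def)
    qed
    obtain t where t: "0 < t" "t < 1"
      "u (X k + (1 * c) *\<^sub>R e) - u (X k + (0 * c) *\<^sub>R e) =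
        (1 - 0) * (c * (G (X k + (t * c) *\<^sub>R e) \<bullet> e))"
      using MVT2[of 0 1, OF _ d] by auto
    have "c * (G (X k + (t * c) *\<^sub>R e) \<bullet> e) < 0"
      using t(3) neg[of k] by (simp add: reflection_diff_def hyp_reflect_def c_def)
    then have "0 \<le> G (X k + (t * c) *\<^sub>R e) \<bullet> e"
      using \<open>c < 0\<close> by (simp add: mult_less_0_iff)
    then show ?thesis using t(1,2) by (auto simp: c_def)
  qed
  then obtain t where t: "\<And>k. 0 < t k" "\<And>k. t k < 1"
    "\<And>k. 0 \<le> G (X k + (t k * (2 * (\<mu> k - X k \<bullet> e))) *\<^sub>R e) \<bullet> e" by metis
  have gap: "(\<lambda>k. 2 * (\<mu> k - X k \<bullet> e)) \<longlonglongrightarrow> 2 * (l - x \<bullet> e)"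
    by (intro tendsto_intros lim)
  have "(\<lambda>k. t k * (2 * (\<mu> k - X k \<bullet> e))) \<longlonglongrightarrow> 0"
  proof (rule Lim_null_comparison)
    show "\<forall>\<^sub>F k in sequentially. norm (t k * (2 * (\<mu> k - X k \<bullet> e))) \<le> \<bar>2 * (\<mu> k - X k \<bullet> e)\<bar>"
      using t(1,2) by (intro always_eventually allI)
        (simp add: abs_mult mult_left_le_one_le less_imp_le)
    show "(\<lambda>k. \<bar>2 * (\<mu> k - X k \<bullet> e)\<bar>) \<longlonglongrightarrow> 0"
      using tendsto_rabs[OF gap] x by simp
  qed
  then have "(\<lambda>k. X k + (t k * (2 * (\<mu> k - X k \<bullet> e))) *\<^sub>R e) \<longlonglongrightarrow> x + 0 *\<^sub>R e"
    by (intro tendsto_intros lim)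
  then have "(\<lambda>k. G (X k + (t k * (2 * (\<mu> k - X k \<bullet> e))) *\<^sub>R e) \<bullet> e) \<longlonglongrightarrow> G x \<bullet> e"
    using continuous_gradient
    by (intro tendsto_inner tendsto_const isCont_tendsto_compose[of x G])
      (auto simp: continuous_on_eq_continuous_at)
  then show ?thesis by (rule LIMSEQ_le_const) (use t(3) in auto)
qed

text \<open>Otherwise the second alternative of the dichotomy holds at \<open>l\<close>. Negative
  points for planes tending to \<open>l\<close> from below converge, modulo periods, to a point of
  the hyperplane, where the derivative along \<open>e\<close> would be both nonnegative and
  negative.\<close>

lemma moving_plane_critical_position:
  assumes e: "z_direction Y e"
    and above: "\<And>\<mu> x. l \<le> \<mu> \<Longrightarrow> \<mu> \<le> x \<bullet> e \<Longrightarrow> 0 \<le> reflection_diff e \<mu> x"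
    and below: "\<And>l'. l' < l \<Longrightarrow> \<exists>\<mu> x. l' < \<mu> \<and> \<mu> \<le> x \<bullet> e \<and> reflection_diff e \<mu> x < 0"
  shows "reflection_diff e l x = 0"
proof (rule ccontr)
  note ne = z_direction_norm[OF e]
  assume "reflection_diff e l x \<noteq> 0"
  with reflection_diff_dichotomy[OF e above[OF order_refl]]
  have pos': "\<And>x. l < x \<bullet> e \<Longrightarrow> 0 < reflection_diff e l x"
    and hopf: "\<And>x. x \<bullet> e = l \<Longrightarrow> G x \<bullet> e < 0"
    by blast+
  obtain R where R: "\<And>x. R < norm (z_part Y x) \<Longrightarrow> u x < \<epsilon>" using decayE[OF eps] by blast
  obtain C where C: "compact (C R)" and cell: "\<And>x. norm (z_part Y x) \<le> R \<Longrightarrow>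
      \<exists>s. (\<forall>i. i \<notin> Y \<longrightarrow> s $ i = 0) \<and> (\<forall>y. u (y + s) = u y) \<and> x + s \<in> C R"
    using compact_cells by metis
  \<comment> \<open>Each negative point is traded for one with \<open>u \<ge> \<epsilon>\<close>,
    whose \<open>z\<close> part is bounded, and then shifted by periods into the fixed compact
    cell.\<close>
  have "\<exists>\<mu> x. l - 1 / real (Suc k) < \<mu> \<and> \<mu> < l \<and> \<mu> < x \<bullet> e \<and> reflection_diff e \<mu> x < 0 \<and> x \<in> C R"
    for k
  proof -
    obtain \<mu> x where \<mu>: "l - 1 / real (Suc k) < \<mu>" "\<mu> \<le> x \<bullet> e" "reflection_diff e \<mu> x < 0"
      using below[of "l - 1 / real (Suc k)"] by auto
    have "\<mu> < l" using above[of \<mu> x] \<mu> by fastforce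
    obtain x0 where x0: "\<mu> < x0 \<bullet> e" "reflection_diff e \<mu> x0 < 0" "\<epsilon> \<le> u x0"
      using negative_reflection_diff_large_value[OF e \<mu>(2,3)] by blast
    have "norm (z_part Y x0) \<le> R" using R[of x0] x0(3) by force
    then obtain s where s: "\<And>i. i \<notin> Y \<Longrightarrow> s $ i = 0" "\<And>y. u (y + s) = u y" "x0 + s \<in> C R"
      using cell by blast
    have "(x0 + s) \<bullet> e = x0 \<bullet> e"
      using z_direction_inner_y[OF e s(1)] by (simp add: inner_add_left)
    then show ?thesis
      using \<mu>(1) \<open>\<mu> < l\<close> x0(1,2) s reflection_diff_shift[OF e s(1,2)] by metis
  qed
  then obtain \<mu> X where \<mu>: "\<And>k. l - 1 / real (Suc k) < \<mu> k" "\<And>k. \<mu> k < l"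
    and X: "\<And>k. \<mu> k < X k \<bullet> e" "\<And>k. reflection_diff e (\<mu> k) (X k) < 0" "\<And>k. X k \<in> C R"
    by metis
  have "\<mu> \<longlonglongrightarrow> l"
  proof (rule tendsto_sandwich[OF _ _ _ tendsto_const])
    show "(\<lambda>k. l - 1 / real (Suc k)) \<longlonglongrightarrow> l"
      using tendsto_diff[OF tendsto_const LIMSEQ_inverse_real_of_nat, of l]
      by (simp add: inverse_eq_divide)
  qed (use \<mu> in \<open>auto intro!: always_eventually less_imp_le\<close>)
  obtain x r where x: "strict_mono (r :: nat \<Rightarrow> nat)" "(X \<circ> r) \<longlonglongrightarrow> x"
    using C X(3) unfolding compact_def by metis
  have \<mu>r: "(\<mu> \<circ> r) \<longlonglongrightarrow> l" using \<open>\<mu> \<longlonglongrightarrow> l\<close> x(1) by (rule LIMSEQ_subseq_LIMSEQ)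
  have Xe: "(\<lambda>k. (X \<circ> r) k \<bullet> e) \<longlonglongrightarrow> x \<bullet> e" by (intro tendsto_intros x)
  have "l \<le> x \<bullet> e"
    by (rule LIMSEQ_le[OF \<mu>r Xe]) (use X(1) in \<open>auto intro: less_imp_le\<close>)
  have cont: "isCont u y" for y
    using continuous_on_u[of UNIV] by (simp add: continuous_on_eq_continuous_at)
  \<comment> \<open>Joint continuity in the plane and the point: the limit has a nonpositive
    difference, so it cannot lie strictly beyond the hyperplane.\<close>
  have "(\<lambda>k. reflection_diff e ((\<mu> \<circ> r) k) ((X \<circ> r) k)) \<longlonglongrightarrow> reflection_diff e l x"
    unfolding reflection_diff_def hyp_reflect_def
    by (intro tendsto_diff isCont_tendsto_compose[OF cont] tendsto_intros x \<mu>r)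
  then have "reflection_diff e l x \<le> 0"
    by (rule LIMSEQ_le_const2) (use X(2) in \<open>auto intro: less_imp_le\<close>)
  with pos'[of x] \<open>l \<le> x \<bullet> e\<close> have "x \<bullet> e = l" by force
  then have "0 \<le> G x \<bullet> e"
    using gradient_limit_nonneg[OF e \<mu>r x(2)] X by simp
  with hopf[OF \<open>x \<bullet> e = l\<close>] show False by simp
qed

text \<open>The plane is at the infimum of the admissible positions. Every plane beyond it falls
  under the strict alternative of the dichotomy, since a second symmetry plane is impossible; this
  gives the sign of the derivative.\<close>

lemma symmetry_plane:
  assumes e: "z_direction Y e"
  shows "\<exists>l. (\<forall>x. reflection_diff e l x = 0) \<and> (\<forall>x. l < x \<bullet> e \<longrightarrow> G x \<bullet> e < 0)"
proof -
  note ne = z_direction_norm[OF e]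
  \<comment> \<open>Quantifying over all \<open>\<mu> \<ge> l\<close> makes the set upward closed,
    so it contains everything above its infimum.\<close>
  define A where
    "A = {l. \<forall>\<mu> x. l \<le> \<mu> \<longrightarrow> \<mu> \<le> x \<bullet> e \<longrightarrow> 0 \<le> reflection_diff e \<mu> x}"
  obtain R where R: "\<And>l x. R < l \<Longrightarrow> l \<le> x \<bullet> e \<Longrightarrow> 0 \<le> reflection_diff e l x"
    using reflection_diff_nonneg_far e by metis
  have "R + 1 \<in> A" using R by (auto simp: A_def)
  then have "A \<noteq> {}" by blast
  obtain l0 where l0: "l0 \<le> 0" "reflection_diff e l0 0 < 0"
    using reflection_diff_negative_at_origin[OF e] by blast
  have bdd: "bdd_below A"
  proof (rule bdd_belowI)
    show "l0 \<le> l" if "l \<in> A" for l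
    proof (rule ccontr)
      assume "\<not> l0 \<le> l"
      with \<open>l \<in> A\<close> l0(1) have "0 \<le> reflection_diff e l0 0" by (simp add: A_def)
      with l0(2) show False by simp
    qed
  qed
  define l where "l = Inf A"
  have in_A: "\<mu> \<in> A" if \<mu>: "l < \<mu>" for \<mu>
  proof -
    obtain a where "a \<in> A" "a < \<mu>"
      using cInf_lessD[OF \<open>A \<noteq> {}\<close>, of \<mu>] \<mu> unfolding l_def by blast
    then show ?thesis by (auto simp: A_def)
  qed
  have cont: "isCont u y" for y
    using continuous_on_u[of UNIV] by (simp add: continuous_on_eq_continuous_at)
  have at_l: "0 \<le> reflection_diff e l x" if "l \<le> x \<bullet> e" for x
  proof (cases "x \<bullet> e = l")
    case False
    have "((\<lambda>\<mu>. reflection_diff e \<mu> x) \<longlongrightarrow> reflection_diff e l x) (at_right l)"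
      unfolding reflection_diff_def hyp_reflect_def
      by (intro tendsto_diff isCont_tendsto_compose[OF cont] tendsto_intros)
    moreover have "\<forall>\<^sub>F \<mu> in at_right l. 0 \<le> reflection_diff e \<mu> x"
      unfolding eventually_at_right_field
      using False that in_A by (intro exI[of _ "x \<bullet> e"]) (auto simp: A_def)
    ultimately show ?thesis by (intro tendsto_lowerbound) auto
  qed (simp add: reflection_diff_boundary)
  have above: "0 \<le> reflection_diff e \<mu> x" if "l \<le> \<mu>" "\<mu> \<le> x \<bullet> e" for \<mu> x
    using that in_A[of \<mu>] at_l by (cases "\<mu> = l") (auto simp: A_def)
  have sym: "reflection_diff e l x = 0" for x
  proof (rule moving_plane_critical_position[OF e above])
    fix l' assume "l' < l"
    \<comment> \<open>The midpoint is still below the infimum and ensures a position strictly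
      greater than \<open>l'\<close>.\<close>
    then have "(l' + l) / 2 \<notin> A" using cInf_lower[OF _ bdd, of "(l' + l) / 2"] by (auto simp: l_def)
    then obtain \<mu> x where "(l' + l) / 2 \<le> \<mu>" "\<mu> \<le> x \<bullet> e" "reflection_diff e \<mu> x < 0"
      by (auto simp: A_def not_le)
    then show "\<exists>\<mu> x. l' < \<mu> \<and> \<mu> \<le> x \<bullet> e \<and> reflection_diff e \<mu> x < 0"
      using \<open>l' < l\<close> by (intro exI[of _ \<mu>] exI[of _ x]) auto
  qed auto
  moreover have "G x \<bullet> e < 0" if x: "l < x \<bullet> e" for x
  proof -
    have "\<not> (\<forall>y. reflection_diff e (x \<bullet> e) y = 0)"
      using symmetry_plane_unique[OF e sym] x by blast
    then show ?thesis
      using reflection_diff_dichotomy[OF e, of "x \<bullet> e"] above x by auto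
  qed
  ultimately show ?thesis by blast
qed

section \<open>Common centre and radial symmetry\<close>

text \<open>The symmetry planes of the coordinate directions determine \<open>z0\<close>. Composing
  their reflections gives the point reflection \<open>N\<close> in \<open>z\<close> about
  \<open>z0\<close>, which carries the symmetry plane at \<open>l\<close> to one at
  \<open>2 * (z0 \<bullet> e) - l\<close>; uniqueness puts \<open>z0\<close> on it.\<close>

lemma reflections_through_common_center:
  "\<exists>z0. (\<forall>i\<in>Y. z0 $ i = 0) \<and>
     (\<forall>e x. z_direction Y e \<longrightarrow> u (hyp_reflect e (z0 \<bullet> e) x) = u x) \<and>
     (\<forall>j x. j \<notin> Y \<longrightarrow> z0 $ j < x $ j \<longrightarrow> G x $ j < 0)"
proof -
  have axis: "z_direction Y (axis j 1)" if "j \<notin> Y" for j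
    using that by (auto simp: z_direction_def axis_def[of j] norm_axis_1[unfolded axis_def])
  obtain c where c: "\<And>j x. j \<notin> Y \<Longrightarrow> reflection_diff (axis j 1) (c j) x = 0"
    and decr: "\<And>j x. j \<notin> Y \<Longrightarrow> c j < x \<bullet> axis j 1 \<Longrightarrow> G x \<bullet> axis j 1 < 0"
    using symmetry_plane[OF axis] by metis
  define z0 where "z0 = (\<chi> j. if j \<in> Y then 0 else c j)"
  define flip where "flip S x = (\<chi> i. if i \<in> S then 2 * z0 $ i - x $ i else x $ i)"
    for S and x :: "real ^ 'n"
  have flip: "u (flip S x) = u x" if "S \<subseteq> - Y" for S x
    using finite[of S] that
  proof (induction S arbitrary: x rule: finite_induct)
    case empty
    then show ?case by (simp add: flip_def)
  next
    case (insert j S)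
    have "flip (insert j S) x = hyp_reflect (axis j 1) (c j) (flip S x)"
      using insert by (auto simp: flip_def hyp_reflect_def vec_eq_iff axis_def z0_def
          inner_axis[unfolded axis_def])
    then show ?case using c[of j "flip S x"] insert by (simp add: reflection_diff_def)
  qed
  have sym: "u (hyp_reflect e (z0 \<bullet> e) x) = u x" if e: "z_direction Y e" for e x
  proof -
    note ne = z_direction_norm[OF e]
    obtain l where l: "\<And>x. reflection_diff e l x = 0" using symmetry_plane[OF e] by blast
    define N where "N = flip (- Y)"
    have N: "u (N x) = u x" for x unfolding N_def by (rule flip) simp
    have N_refl: "N (hyp_reflect e l (N x)) = hyp_reflect e (2 * (z0 \<bullet> e) - l) x" for x
    proof -
      have "N x \<bullet> e = 2 * (z0 \<bullet> e) - x \<bullet> e"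
        unfolding inner_vec_def sum_distrib_left sum_subtractf[symmetric]
        by (rule sum.cong)
          (use e in \<open>auto simp: N_def flip_def z_direction_def algebra_simps\<close>)
      then have "hyp_reflect e l (N x) = N x + (2 * (l - (2 * (z0 \<bullet> e) - x \<bullet> e))) *\<^sub>R e"
        by (simp add: hyp_reflect_def)
      then show ?thesis
        using e by (auto simp: hyp_reflect_def N_def flip_def vec_eq_iff z_direction_def
            algebra_simps)
    qed
    have "reflection_diff e (2 * (z0 \<bullet> e) - l) x = 0" for x
      using l[of "N x"] N[of x] N[of "hyp_reflect e l (N x)"]
      by (simp add: reflection_diff_def N_refl)
    then have "l = 2 * (z0 \<bullet> e) - l" using symmetry_plane_unique[OF e l] by blast
    then have "l = z0 \<bullet> e" by simp
    with l[of x] show ?thesis by (simp add: reflection_diff_def)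
  qed
  have "G x $ j < 0" if "j \<notin> Y" "z0 $ j < x $ j" for j x
    using decr[of j x] that by (simp add: inner_axis z0_def)
  then show ?thesis using sym by (intro exI[of _ z0]) (auto simp: z0_def)
qed

text \<open>Distinct \<open>a\<close> and \<open>b\<close> are exchanged by the reflection in their
  bisecting hyperplane. Its normal has no \<open>y\<close> components because the \<open>y\<close>
  parts agree, and it contains \<open>z0\<close> because the distances agree.\<close>

lemma radially_symmetric:
  assumes z0: "\<And>i. i \<in> Y \<Longrightarrow> z0 $ i = 0"
    and sym: "\<And>e x. z_direction Y e \<Longrightarrow> u (hyp_reflect e (z0 \<bullet> e) x) = u x"
    and y: "y_part Y a = y_part Y b"
    and z: "norm (z_part Y a - z0) = norm (z_part Y b - z0)"
  shows "u a = u b"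
proof (cases "a = b")
  case False
  define d where "d = b - a"
  define e where "e = d /\<^sub>R norm d"
  have "d \<noteq> 0" using False by (simp add: d_def)
  have dY: "d $ i = 0" if "i \<in> Y" for i
    using arg_cong[OF y, of "\<lambda>v. v $ i"] that by (simp add: d_def y_part_def)
  have e: "z_direction Y e"
    using \<open>d \<noteq> 0\<close> dY by (simp add: z_direction_def e_def)
  have yz: "v \<bullet> d = z_part Y v \<bullet> d" for v
    unfolding inner_vec_def by (rule sum.cong) (use dY in \<open>auto simp: z_part_def\<close>)
  have d_eq: "d = (z_part Y b - z0) - (z_part Y a - z0)"
    using dY by (auto simp: vec_eq_iff d_def z_part_def)
  have "(z_part Y b - z0) \<bullet> (z_part Y b - z0) = (z_part Y a - z0) \<bullet> (z_part Y a - z0)"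
    using z by (simp flip: power2_norm_eq_inner)
  \<comment> \<open>For vectors of equal length, sum and difference are orthogonal; this says that
    \<open>z0\<close> is on the bisecting hyperplane.\<close>
  then have "((z_part Y b - z0) + (z_part Y a - z0)) \<bullet> d = 0"
    unfolding d_eq by (rule inner_sum_diff)
  then have "2 * (z0 \<bullet> d) - 2 * (a \<bullet> d) = d \<bullet> d"
  proof -
    have "d \<bullet> d = b \<bullet> d - a \<bullet> d"
      unfolding d_def inner_diff_left ..
    moreover have "b \<bullet> d + a \<bullet> d = 2 * (z0 \<bullet> d)"
      using \<open>_ \<bullet> d = 0\<close> yz[of a] yz[of b] unfolding inner_add_left inner_diff_left by linarith
    ultimately show ?thesis by linarith
  qed
  then have "(2 * (z0 \<bullet> e - a \<bullet> e)) *\<^sub>R e = d"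
    using \<open>d \<noteq> 0\<close> by (simp add: e_def field_simps power2_norm_eq_inner[symmetric] power2_eq_square)
  then have "hyp_reflect e (z0 \<bullet> e) a = b" by (simp add: hyp_reflect_def d_def)
  with sym[OF e, of a] show ?thesis by simp
qed simp

end

subsection \<open>Classical solutions\<close>

lemma has_derivative_gradient_partial_deriv:
  assumes "u differentiable (at x)"
  shows "(u has_derivative (\<lambda>h. (\<chi> i. partial_deriv i u x) \<bullet> h)) (at x)"
proof -
  have D: "(u has_derivative frechet_derivative u (at x)) (at x)"
    using assms frechet_derivative_works by blast
  have eq: "frechet_derivative u (at x) h = (\<chi> i. partial_deriv i u x) \<bullet> h" for h
  proof -
    have lin: "linear (frechet_derivative u (at x))"
      using assms by (rule linear_frechet_derivative)
    have "frechet_derivative u (at x) h = frechet_derivative u (at x) (\<Sum>i\<in>UNIV. h $ i *s axis i 1)"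
      by (simp only: basis_expansion)
    also have "\<dots> = (\<Sum>i\<in>UNIV. h $ i * partial_deriv i u x)"
      by (simp add: linear_sum[OF lin] linear_scale[OF lin] scalar_mult_eq_scaleR partial_deriv_def)
    finally show ?thesis by (simp add: inner_vec_def mult.commute)
  qed
  show ?thesis by (rule has_derivative_eq_rhs[OF D ext[OF eq]])
qed

text \<open>The rows of the Hessian are the gradients of the partial derivatives, and its trace in
  the standard basis is the sum of the pure second derivatives.\<close>

lemma C2_function_has_laplacian:
  assumes "C2_function u"
  shows "has_laplacian u (laplacian u x) x"
proof -
  define H where "H h = (\<chi> i. (\<chi> k. partial_deriv k (partial_deriv i u) x) \<bullet> h)" for h
  show ?thesis
    unfolding has_laplacian_def
  proof (rule exI[of _ "\<lambda>y. \<chi> i. partial_deriv i u y"], rule exI[of _ H], intro conjI allI)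
    show "(u has_derivative (\<lambda>h. (\<chi> i. partial_deriv i u y) \<bullet> h)) (at y)" for y
      using assms by (intro has_derivative_gradient_partial_deriv)
        (simp add: C2_function_def C1_function_def)
    show "((\<lambda>y. \<chi> i. partial_deriv i u y) has_derivative H) (at x)"
    proof (subst has_derivative_componentwise_within, intro ballI)
      fix b :: "real ^ 'a" assume "b \<in> Basis"
      then obtain i where b: "b = axis i 1" by (auto simp: Basis_vec_def)
      have "(partial_deriv i u has_derivative
          (\<lambda>h. (\<chi> k. partial_deriv k (partial_deriv i u) x) \<bullet> h)) (at x)"
        using assms by (intro has_derivative_gradient_partial_deriv)
          (simp add: C2_function_def C1_function_def)
      then show "((\<lambda>y. (\<chi> i. partial_deriv i u y) \<bullet> b) has_derivative (\<lambda>h. H h \<bullet> b)) (at x)"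
        by (simp add: b H_def inner_axis)
    qed
    have "(\<Sum>b\<in>Basis. H b \<bullet> b) = (\<Sum>i\<in>UNIV. H (axis i 1) \<bullet> axis i 1)"
    proof (rule sum.reindex_cong[where l = "\<lambda>i. axis i 1"])
      show "inj (\<lambda>i :: 'a. axis i (1 :: real))" by (auto simp: inj_def axis_eq_axis)
      show "Basis = range (\<lambda>i :: 'a. axis i (1 :: real))" by (auto simp: Basis_vec_def)
    qed simp
    also have "\<dots> = laplacian u x"
      by (simp add: H_def inner_axis laplacian_def)
    finally show "laplacian u x = (\<Sum>b\<in>Basis. H b \<bullet> b)" ..
  qed
qed

text \<open>The continuous derivative is bounded on the compact interval, and the bound serves as
  Lipschitz constant.\<close>

lemma C1_differentiable_lipschitz_interval:
  fixes f :: "real \<Rightarrow> real"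
  assumes "f C1_differentiable_on UNIV"
  shows "\<exists>K\<ge>0. \<forall>s\<in>{a..b}. \<forall>t\<in>{a..b}. \<bar>f s - f t\<bar> \<le> K * \<bar>s - t\<bar>"
proof -
  obtain D where D: "\<And>x. (f has_real_derivative D x) (at x)" "continuous_on UNIV D"
    using assms unfolding C1_differentiable_on_def has_real_derivative_iff_has_vector_derivative
    by blast
  have "bounded (D ` {a..b})"
    using D(2) by (intro compact_imp_bounded compact_continuous_image)
      (auto intro: continuous_on_subset)
  then obtain K where K: "0 < K" "\<And>x. x \<in> {a..b} \<Longrightarrow> \<bar>D x\<bar> \<le> K"
    unfolding bounded_pos by auto
  have "\<bar>f s - f t\<bar> \<le> K * \<bar>s - t\<bar>" if "s \<in> {a..b}" "t \<in> {a..b}" for s t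
    using field_differentiable_bound[of "{a..b}" f D K s t] D(1) K(2) that
    by (auto intro: has_field_derivative_at_within)
  with K(1) show ?thesis by (intro exI[of _ K]) auto
qed

lemma nonpos_deriv_antimono:
  fixes f :: "real \<Rightarrow> real"
  assumes "f C1_differentiable_on UNIV" "\<forall>s\<in>{0<..<\<epsilon>}. deriv f s \<le> 0"
    and "0 < a" "a \<le> b" "b < \<epsilon>"
  shows "f b \<le> f a"
proof (rule DERIV_nonpos_imp_nonincreasing[OF \<open>a \<le> b\<close>])
  fix x assume x: "a \<le> x" "x \<le> b"
  obtain D where D: "\<And>x. (f has_real_derivative D x) (at x)"
    using assms(1) unfolding C1_differentiable_on_def has_real_derivative_iff_has_vector_derivative
    by blast
  have "x \<in> {0<..<\<epsilon>}" using assms x by auto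
  with assms(2) have "D x \<le> 0" using DERIV_imp_deriv[OF D, of x] by metis
  with D show "\<exists>y. (f has_real_derivative y) (at x) \<and> y \<le> 0" by blast
qed

theorem theorem2:
  fixes Y :: "'n::finite set"
    and f :: "real \<Rightarrow> real"
    and u :: "real ^ 'n \<Rightarrow> real"
  assumes "card Y < CARD('n)"
    and "f C1_differentiable_on UNIV"
    and "f 0 = 0"
    and "\<exists>\<epsilon>>0. \<forall>s\<in>{0<..<\<epsilon>}. deriv f s \<le> 0"
    and "C2_function u"
    and "\<forall>x. u x > 0"
    and "bounded (range u)"
    and "\<forall>x. - laplacian u x = f (u x)"
    and "periodic_in_y Y u"
    and "vanishes_uniformly_in_y Y u"
  shows "\<exists>z0 :: real ^ 'n. (\<forall>i\<in>Y. z0 $ i = 0) \<and>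
           (\<exists>g :: real ^ 'n \<Rightarrow> real \<Rightarrow> real.
              \<forall>x. u x = g (y_part Y x) (norm (z_part Y x - z0))) \<and>
           (\<forall>j. j \<notin> Y \<longrightarrow> (\<forall>x. x $ j > z0 $ j \<longrightarrow> partial_deriv j u x < 0))"
proof -
  obtain \<epsilon> where \<epsilon>: "\<epsilon> > 0" "\<forall>s\<in>{0<..<\<epsilon>}. deriv f s \<le> 0" using assms(4) by blast
  obtain B where B: "\<And>x. \<bar>u x\<bar> \<le> B" using assms(7) by (auto simp: bounded_iff)
  obtain K where K: "0 \<le> K" "\<And>s t. s \<in> {0..B} \<Longrightarrow> t \<in> {0..B} \<Longrightarrow> \<bar>f s - f t\<bar> \<le> K * \<bar>s - t\<bar>"
    using C1_differentiable_lipschitz_interval[OF assms(2)] by metis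
  define G where "G x = (\<chi> i. partial_deriv i u x)" for x
  interpret decaying_solution Y f u G K \<epsilon>
  proof
    show "(u has_derivative (\<lambda>h. G x \<bullet> h)) (at x)" for x
      unfolding G_def using assms(5)
      by (intro has_derivative_gradient_partial_deriv) (simp add: C2_function_def C1_function_def)
    show "continuous_on UNIV G"
      unfolding G_def using assms(5)
      by (intro continuous_on_vec_lambda) (simp add: C2_function_def C1_function_def)
    show "has_laplacian u (- f (u x)) x" for x
      using C2_function_has_laplacian[OF assms(5), of x] assms(8) by (metis minus_minus)
    have "u x \<in> {0..B}" for x using assms(6) B[of x] by (auto simp: less_imp_le)
    then show "\<bar>f (u x) - f (u y)\<bar> \<le> K * \<bar>u x - u y\<bar>" for x y by (rule K(2)) fact+
    show "f b \<le> f a" if "0 < a" "a \<le> b" "b < \<epsilon>" for a b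
      using nonpos_deriv_antimono[OF assms(2) \<epsilon>(2) that] .
  qed (use assms K(1) \<epsilon>(1) in auto)
  obtain z0 where z0: "\<And>i. i \<in> Y \<Longrightarrow> z0 $ i = 0"
    and sym: "\<And>e x. z_direction Y e \<Longrightarrow> u (hyp_reflect e (z0 \<bullet> e) x) = u x"
    and decr: "\<And>j x. j \<notin> Y \<Longrightarrow> z0 $ j < x $ j \<Longrightarrow> G x $ j < 0"
    using reflections_through_common_center by blast
  obtain j where j: "j \<notin> Y" using assms(1) by (metis UNIV_eq_I less_irrefl)
  \<comment> \<open>The profile is read off along the ray from \<open>z0\<close> in one fixed
    \<open>z\<close> direction; \<open>j\<close> exists because \<open>Y\<close> is a proper subset
    of the indices.\<close>
  define g where "g y r = u (y + z0 + r *\<^sub>R axis j 1)" for y and r :: real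
  have "u x = g (y_part Y x) (norm (z_part Y x - z0))" for x
  proof -
    define r where "r = norm (z_part Y x - z0)"
    define x' where "x' = y_part Y x + z0 + r *\<^sub>R axis j 1"
    have "y_part Y x' = y_part Y x"
      using z0 j by (auto simp: vec_eq_iff y_part_def x'_def axis_def)
    moreover have "z_part Y x' - z0 = r *\<^sub>R axis j 1"
      using z0 j by (auto simp: vec_eq_iff y_part_def z_part_def x'_def axis_def)
    then have "norm (z_part Y x' - z0) = norm (z_part Y x - z0)" by (simp add: r_def)
    ultimately have "u x = u x'" by (intro radially_symmetric[OF z0 sym]) auto
    then show ?thesis by (simp add: g_def x'_def r_def)
  qed
  then show ?thesis
    using z0 decr by (intro exI[of _ z0] conjI exI[of _ g]) (auto simp: G_def)
qed

end
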